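(* For every $n\ge 1$ there is a constant $c_n>0$ depending only on $n$ such that, for every weight $w$ in $\mathbb{R}^n$, every $\frac12\le\delta<1$ and every $u\in\mathcal{F}_w$, $$\left(\int_{\mathbb{R}^n}|u(x)|^{\frac{n}{n-\delta}}\,w(x)\,dx\right)^{\frac{n-\delta}{n}}\le c_n\,(1-\delta)\int_{\mathbb{R}^n}\int_{\mathbb{R}^n}\frac{|u(x)-u(y)|}{|x-y|^{n+\delta}}\,dy\,\big(Mw(x)\big)^{\frac{n-\delta}{n}}\,dx.$$
   Context: A cube in $\mathbb{R}^n$ is a cartesian product of $n$ intervals of the same side length. A weight is a function $w\in L^1_{\mathrm{loc}}(\mathbb{R}^n)$ with $w(x)>0$ for a.e. $x$; $w(Q)=\int_Q w\,dx$. $M$ is the non-centered Hardy–Littlewood maximal function $Mf(x)=\sup_{R\ni x}\frac1{|R|}\int_R|f|\,dy$, the supremum over all cubes $R$ in $\mathbb{R}^n$ containing $x$. For a weight $w$, $\mathcal{F}_w$ is the class of functions $u\in L^1_{\mathrm{loc}}(\mathbb{R}^n)\cap L^1_{\mathrm{loc}}(\mathbb{R}^n;w\,dx)$ for which there exists an increasing sequence of cubes $\{Q_j\}_{j\in\mathbb{N}}$ with $\mathbb{R}^n=\bigcup_j Q_j$ and $\lim_{j\to\infty}\frac1{w(Q_j)}\int_{Q_j}u\,w\,dx=0$. *)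

theory Defs
  imports "HOL-Analysis.Analysis"
begin

text \<open>The sides may be open, closed or half-open, but they are nondegenerate and bounded;
  the length of an interval is its Lebesgue measure.\<close>

definition is_cube :: "(real ^ 'n) set \<Rightarrow> bool" where
  "is_cube Q \<longleftrightarrow>
    (\<exists>I l. 0 < l \<and> (\<forall>i. is_interval (I i) \<and> emeasure lborel (I i) = ennreal l) \<and>
           Q = {x. \<forall>i. x $ i \<in> I i})"

text \<open>Membership in \<open>L\<^sup>1\<^sub>l\<^sub>o\<^sub>c\<close> with respect to a measure \<open>M\<close>.\<close>

definition locally_integrable ::
    "(real ^ 'n) measure \<Rightarrow> (real ^ 'n \<Rightarrow> real) \<Rightarrow> bool" where
  "locally_integrable M f \<longleftrightarrow> (\<forall>K. compact K \<longrightarrow> set_integrable M K f)"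

definition weight :: "(real ^ 'n \<Rightarrow> real) \<Rightarrow> bool" where
  "weight w \<longleftrightarrow> locally_integrable lebesgue w \<and> (AE x in lebesgue. 0 < w x)"

text \<open>The maximal function is extended-valued: for a weight it may be infinite.\<close>

definition maximal_function :: "(real ^ 'n \<Rightarrow> real) \<Rightarrow> real ^ 'n \<Rightarrow> ennreal" where
  "maximal_function f x =
    (SUP R \<in> {R. is_cube R \<and> x \<in> R}.
      (\<integral>\<^sup>+ y \<in> R. ennreal \<bar>f y\<bar> \<partial>lebesgue) / emeasure lebesgue R)"

definition class_F :: "(real ^ 'n \<Rightarrow> real) \<Rightarrow> (real ^ 'n \<Rightarrow> real) set" where
  "class_F w =
    {u. locally_integrable lebesgue u \<and>
        locally_integrable (density lebesgue (\<lambda>x. ennreal (w x))) u \<and>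
        (\<exists>Q. (\<forall>j. is_cube (Q j)) \<and> incseq Q \<and> (\<Union>j. Q j) = UNIV \<and>
             (\<lambda>j. (LINT x:Q j|lebesgue. u x * w x) / (LINT x:Q j|lebesgue. w x))
               \<longlonglongrightarrow> 0)}"

text \<open>Powers of extended nonnegative numbers; only used for exponents \<open>p > 0\<close>.\<close>

definition ennreal_powr :: "ennreal \<Rightarrow> real \<Rightarrow> ennreal" where
  "ennreal_powr a p = (if a = \<infinity> then \<infinity> else ennreal (enn2real a powr p))"

end

theory Submission
  imports Defs
begin

text \<open>
  Write \<open>n\<close> for the dimension and \<open>p = n / (n - \<delta>)\<close>.  The inequality is an isoperimetric
  inequality for sets, integrated over the level sets of \<open>u\<close>.

  The gain of the factor \<open>1 - \<delta>\<close> is unweighted and already present in \<open>L\<^sup>1\<close>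
  (\<open>fractional_Poincare_convex\<close>).  On a convex set, the total oscillation over increments of length
  at most \<open>2 s\<close> is at most \<open>2\<^sup>n\<^sup>+\<^sup>1\<close> times the one over increments of length at most \<open>s\<close>, by going
  through the midpoint.  Hence each dyadic scale \<open>2\<^sup>-\<^sup>k\<close> contributes at least \<open>2\<^sup>-\<^sup>k\<^sup>(\<^sup>1\<^sup>-\<^sup>\<delta>\<^sup>)\<close> times the mean
  oscillation to the fractional energy, and the geometric series sums to at least \<open>1 / (1 - \<delta>)\<close>.
  Applied to an indicator function, this says that a cube of side \<open>r\<close> in which a set \<open>E\<close> and its
  complement both occupy a fixed fraction carries an energy of at least \<open>r\<^sup>n\<^sup>-\<^sup>\<delta> / (1 - \<delta>)\<close> up to a
  constant (\<open>relative_isoperimetric_cube\<close>).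

  The weight enters through a stopping time.  If \<open>E\<close> fills at most half of a cube \<open>Q\<close>, then almost
  every point of \<open>E\<close> lies in a dyadic subcube of \<open>Q\<close> in which the density of \<open>E\<close> is between
  \<open>2\<^sup>-\<^sup>n\<^sup>-\<^sup>1\<close> and \<open>1/2\<close>, and the maximal such cubes \<open>R\<close> are disjoint.  On each of them
  \<open>w(R)\<^sup>1\<^sup>/\<^sup>p = (w(R) / |R|)\<^sup>1\<^sup>/\<^sup>p r\<^sup>n\<^sup>-\<^sup>\<delta>\<close>, where the average is at most \<open>Mw\<close> at every point of \<open>R\<close> and
  the power of the side is at most a constant times \<open>1 - \<delta>\<close> times the energy of \<open>E\<close> in \<open>R\<close>.  Since \<open>t \<mapsto> t\<^sup>1\<^sup>/\<^sup>p\<close> is subadditive,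
  the sum over the cubes \<open>R\<close> bounds \<open>w(E)\<^sup>1\<^sup>/\<^sup>p\<close>; exchanging \<open>E\<close> with its complement gives a bound for
  the smaller of \<open>w(E)\<close> and \<open>w(Q - E)\<close> without restriction on \<open>E\<close> (\<open>weighted_isoperimetric\<close>).

  A Minkowski-type inequality bounds the \<open>L\<^sup>p(w)\<close> norm of \<open>u\<close> minus its mean over \<open>Q\<close> by twice the
  integral over \<open>t\<close> of \<open>min (w {u > t}) (w {u \<le> t})\<close> to the power \<open>1/p\<close> (\<open>level_set_Minkowski\<close>), while
  \<open>|u x - u y|\<close> is the integral over \<open>t\<close> of the jumps of the indicators of \<open>{u > t}\<close>.  Together these
  yield a weighted Poincare-Sobolev inequality on every cube with a constant independent of the cube
  (\<open>weighted_Poincare_Sobolev_is_cube\<close>).  Along the cubes in the definition of the class of \<open>u\<close> the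
  means tend to zero, and Fatou's lemma gives the inequality on the whole space.
\<close>

section \<open>The fractional Poincare inequality on convex sets\<close>

lemma nn_integral_lborel_shift:
  fixes f :: "'a::euclidean_space \<Rightarrow> ennreal"
  assumes [measurable]: "f \<in> borel_measurable borel"
  shows "(\<integral>\<^sup>+x. f (c + x) \<partial>lborel) = (\<integral>\<^sup>+x. f x \<partial>lborel)"
proof -
  have "(\<integral>\<^sup>+x. f x \<partial>lborel) = (\<integral>\<^sup>+x. f x \<partial>distr lborel borel ((+) c))"
    by (simp add: lborel_distr_plus)
  also have "\<dots> = (\<integral>\<^sup>+x. f (c + x) \<partial>lborel)"
    by (rule nn_integral_distr) auto
  finally show ?thesis by simp
qed

lemma nn_integral_lborel_dilate:
  fixes f :: "'a::euclidean_space \<Rightarrow> ennreal"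
  assumes [measurable]: "f \<in> borel_measurable borel" and c: "0 < c"
  shows "(\<integral>\<^sup>+x. f x \<partial>lborel) = ennreal (c ^ DIM('a)) * (\<integral>\<^sup>+x. f (c *\<^sub>R x) \<partial>lborel)"
proof -
  have eq: "lborel = density (distr lborel borel (\<lambda>x::'a. 0 + c *\<^sub>R x)) (\<lambda>_. \<bar>c\<bar>^DIM('a))"
    using c by (intro lborel_affine) auto
  have "(\<integral>\<^sup>+x. f x \<partial>lborel) = (\<integral>\<^sup>+x. ennreal (c ^ DIM('a)) * f x \<partial>distr lborel borel (\<lambda>x::'a. 0 + c *\<^sub>R x))"
    using c by (subst eq, subst nn_integral_density) auto
  also have "\<dots> = (\<integral>\<^sup>+x. ennreal (c ^ DIM('a)) * f (0 + c *\<^sub>R x) \<partial>lborel)"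
    by (rule nn_integral_distr) auto
  also have "\<dots> = ennreal (c ^ DIM('a)) * (\<integral>\<^sup>+x. f (c *\<^sub>R x) \<partial>lborel)"
    by (simp add: nn_integral_cmult)
  finally show ?thesis .
qed

text \<open>An integrated \<open>L\<^sup>1\<close> modulus of continuity: all increments \<open>z\<close> of length at most \<open>s\<close> count, and
  both ends of an increment have to lie in \<open>R\<close>.\<close>
definition oscillation :: "'a::euclidean_space set \<Rightarrow> ('a \<Rightarrow> real) \<Rightarrow> real \<Rightarrow> ennreal" where
  "oscillation R f s =
     (\<integral>\<^sup>+z. indicator (cball 0 s) z *
        (\<integral>\<^sup>+x. indicator R x * indicator R (x + z) * ennreal \<bar>f (x + z) - f x\<bar> \<partial>lborel) \<partial>lborel)"

text \<open>An increment of \<open>f\<close> along \<open>2 z\<close> is the sum of two increments along \<open>z\<close>, and convexity keeps the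
  midpoint in \<open>R\<close>; this accounts for a factor \<open>2\<close>.  The substitution \<open>z \<mapsto> 2 z\<close> accounts for \<open>2\<^sup>n\<close>.\<close>
lemma oscillation_doubling:
  fixes f :: "'a::euclidean_space \<Rightarrow> real"
  assumes [measurable]: "f \<in> borel_measurable borel" "R \<in> sets borel" and R: "convex R"
  shows "oscillation R f (2 * s) \<le> ennreal (2 ^ (DIM('a) + 1)) * oscillation R f s"
proof -
  have cb[measurable]: "cball (0::'a) r \<in> sets borel" for r by simp
  define h where "h z x = indicator R x * indicator R (x + z) * ennreal \<bar>f (x + z) - f x\<bar>" for z x
  have h[measurable]: "(\<lambda>(z, x). h z x) \<in> borel_measurable (lborel \<Otimes>\<^sub>M lborel)"
    unfolding h_def by measurable
  have hs[measurable]: "h z \<in> borel_measurable borel" for z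
    unfolding h_def by measurable
  have tri: "h (2 *\<^sub>R z) x \<le> h z x + h z (z + x)" for z x
  proof (cases "x \<in> R \<and> x + 2 *\<^sub>R z \<in> R")
    case True
    then have "(1/2) *\<^sub>R x + (1/2) *\<^sub>R (x + 2 *\<^sub>R z) \<in> R"
      using R by (intro convexD) auto
    moreover have "(1/2) *\<^sub>R x + (1/2) *\<^sub>R (x + 2 *\<^sub>R z) = x + z"
      by (simp add: algebra_simps flip: scaleR_add_left)
    ultimately have "x + z \<in> R" by simp
    moreover have "ennreal \<bar>f (x + 2 *\<^sub>R z) - f x\<bar> \<le>
        ennreal \<bar>f (x + z) - f x\<bar> + ennreal \<bar>f (z + x + z) - f (z + x)\<bar>"
      by (subst ennreal_plus[symmetric], simp, simp, rule ennreal_leI) (auto simp: scaleR_2 algebra_simps)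
    ultimately show ?thesis
      using True by (simp add: h_def algebra_simps scaleR_2)
  qed (auto simp: h_def)
  \<comment> \<open>The second of the two increments is a translate of the first, so both have the same integral.\<close>
  have 2: "(\<integral>\<^sup>+x. h (2 *\<^sub>R z) x \<partial>lborel) \<le> 2 * (\<integral>\<^sup>+x. h z x \<partial>lborel)" for z
  proof -
    have "(\<integral>\<^sup>+x. h (2 *\<^sub>R z) x \<partial>lborel) \<le> (\<integral>\<^sup>+x. h z x + h z (z + x) \<partial>lborel)"
      by (intro nn_integral_mono tri)
    also have "\<dots> = (\<integral>\<^sup>+x. h z x \<partial>lborel) + (\<integral>\<^sup>+x. h z (z + x) \<partial>lborel)"
      by (rule nn_integral_add) auto
    also have "(\<integral>\<^sup>+x. h z (z + x) \<partial>lborel) = (\<integral>\<^sup>+x. h z x \<partial>lborel)"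
      by (rule nn_integral_lborel_shift) auto
    finally show ?thesis by (simp add: mult_2)
  qed
  have m: "(\<lambda>z. \<integral>\<^sup>+x. h z x \<partial>lborel) \<in> borel_measurable borel"
    using lborel.borel_measurable_nn_integral[OF h] by simp
  note m[measurable]
  have "oscillation R f (2 * s) = (\<integral>\<^sup>+z. indicator (cball 0 (2 * s)) z * (\<integral>\<^sup>+x. h z x \<partial>lborel) \<partial>lborel)"
    by (simp add: oscillation_def h_def)
  also have "\<dots> = ennreal (2 ^ DIM('a)) *
      (\<integral>\<^sup>+z. indicator (cball 0 (2 * s)) (2 *\<^sub>R z) * (\<integral>\<^sup>+x. h (2 *\<^sub>R z) x \<partial>lborel) \<partial>lborel)"
    by (rule nn_integral_lborel_dilate) (auto intro!: borel_measurable_times_ennreal borel_measurable_indicator m)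
  also have "\<dots> \<le> ennreal (2 ^ DIM('a)) *
      (\<integral>\<^sup>+z. 2 * (indicator (cball 0 s) z * (\<integral>\<^sup>+x. h z x \<partial>lborel)) \<partial>lborel)"
  proof (intro mult_left_mono nn_integral_mono)
    fix z :: 'a
    show "indicator (cball 0 (2 * s)) (2 *\<^sub>R z) * (\<integral>\<^sup>+x. h (2 *\<^sub>R z) x \<partial>lborel)
        \<le> 2 * (indicator (cball 0 s) z * (\<integral>\<^sup>+x. h z x \<partial>lborel))"
      using 2[of z] by (auto simp: indicator_def)
  qed simp
  also have "\<dots> = ennreal (2 ^ DIM('a)) * (2 * oscillation R f s)"
    by (subst nn_integral_cmult) (auto simp: oscillation_def h_def[abs_def])
  also have "\<dots> = ennreal (2 ^ (DIM('a) + 1)) * oscillation R f s"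
  proof -
    have "ennreal (2 ^ (DIM('a) + 1)) = ennreal (2 ^ DIM('a)) * ennreal 2"
      by (subst ennreal_mult'[symmetric]) (auto simp: mult.commute)
    then show ?thesis by (simp add: mult.assoc)
  qed
  finally show ?thesis .
qed

lemma oscillation_scales:
  fixes f :: "'a::euclidean_space \<Rightarrow> real"
  assumes "f \<in> borel_measurable borel" "R \<in> sets borel" "convex R"
  shows "oscillation R f d \<le> ennreal (2 ^ (k * (DIM('a) + 1))) * oscillation R f (d / 2 ^ k)"
proof (induction k)
  case (Suc k)
  have "oscillation R f (d / 2 ^ k) \<le> ennreal (2 ^ (DIM('a) + 1)) * oscillation R f (d / 2 ^ Suc k)"
    using oscillation_doubling[OF assms, of "d / 2 ^ Suc k"] by simp
  then have "ennreal (2 ^ (k * (DIM('a) + 1))) * oscillation R f (d / 2 ^ k)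
    \<le> ennreal (2 ^ (k * (DIM('a) + 1))) * (ennreal (2 ^ (DIM('a) + 1)) * oscillation R f (d / 2 ^ Suc k))"
    by (rule mult_left_mono) simp
  also have "\<dots> = ennreal (2 ^ (Suc k * (DIM('a) + 1))) * oscillation R f (d / 2 ^ Suc k)"
    unfolding mult.assoc[symmetric] by (subst ennreal_mult'[symmetric]) (auto simp: power_add mult_ac)
  finally show ?case using Suc by (rule order_trans[rotated])
qed simp

text \<open>Since \<open>s \<ge> 1\<close>, the numbers \<open>(d / 2\<^sup>k) powr - s\<close> at least double from one scale to the next, so their
  sum over the scales not below \<open>r\<close> is at most twice the last of them.  The sum is thus a
  discrete substitute for the kernel \<open>r powr - s\<close>.\<close>
lemma dyadic_kernel_sum:
  fixes d r s :: real
  assumes d: "0 < d" and s: "1 \<le> s" and r: "0 < r"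
  shows "(\<Sum>k. ennreal ((d / 2 ^ k) powr - s) * indicator {..d / 2 ^ k} r) \<le> ennreal (2 * r powr - s)"
proof -
  define t where "t k = (d / 2 ^ k) powr - s" for k :: nat
  have t0: "0 < t k" for k using d by (simp add: t_def)
  have t2: "2 * t k \<le> t (Suc k)" for k
  proof -
    have "t (Suc k) = (d / 2 ^ k) powr - s * (1/2) powr - s"
      unfolding t_def using d by (subst powr_mult[symmetric]) (auto simp: field_simps)
    moreover have "(2::real) \<le> (1/2) powr - s"
    proof -
      have "(2::real) powr 1 \<le> 2 powr s" using s by (intro powr_mono) auto
      then show ?thesis by (simp add: powr_minus powr_divide)
    qed
    ultimately show ?thesis
      using t0[of k] by (simp add: t_def mult_ac)
  qed
  have geo: "(\<Sum>k\<le>m. t k) \<le> 2 * t m" for m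
  proof (induction m)
    case 0 then show ?case using t0[of 0] by simp
  next
    case (Suc m) then show ?case using t2[of m] by simp
  qed
  have part: "(\<Sum>k<m. t k * indicator {..d / 2 ^ k} r) \<le> 2 * r powr - s" for m
  proof (induction m)
    case (Suc m)
    show ?case
    proof (cases "r \<le> d / 2 ^ m")
      case True
      have "(\<Sum>k<Suc m. t k * indicator {..d / 2 ^ k} r) \<le> (\<Sum>k\<le>m. t k)"
        unfolding lessThan_Suc_atMost using t0
        by (intro sum_mono) (auto simp: indicator_def less_imp_le)
      also have "\<dots> \<le> 2 * t m" by (rule geo)
      also have "\<dots> \<le> 2 * r powr - s"
        unfolding t_def using True r s by (simp add: powr_mono2')
      finally show ?thesis .
    qed (use Suc in auto)
  qed simp
  show ?thesis
  proof (rule suminf_le_const)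
    fix m
    have "(\<Sum>k<m. ennreal ((d / 2 ^ k) powr - s) * indicator {..d / 2 ^ k} r)
      = (\<Sum>k<m. ennreal (t k * indicator {..d / 2 ^ k} r))"
      by (intro sum.cong) (auto simp: t_def indicator_def)
    also have "\<dots> = ennreal (\<Sum>k<m. t k * indicator {..d / 2 ^ k} r)"
      using t0 by (intro sum_ennreal) (auto simp: less_imp_le)
    also have "\<dots> \<le> ennreal (2 * r powr - s)" by (intro ennreal_leI part)
    finally show "(\<Sum>k<m. ennreal ((d / 2 ^ k) powr - s) * indicator {..d / 2 ^ k} r) \<le> ennreal (2 * r powr - s)" .
  qed auto
qed

text \<open>The source of the factor \<open>1 - \<delta>\<close>: the scales contribute a geometric series whose ratio
  \<open>2 powr (\<delta> - 1)\<close> is at least \<open>\<delta>\<close>.\<close>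
lemma geometric_scales:
  fixes \<delta> :: real
  assumes "\<delta> < 1"
  shows "ennreal (1 / (1 - \<delta>)) \<le> (\<Sum>k. ennreal ((2 powr (\<delta> - 1)) ^ k))"
proof -
  let ?q = "2 powr (\<delta> - 1) :: real"
  have q: "0 < ?q" "?q < 1" using assms by (auto simp: powr_less_one)
  have "1 + (\<delta> - 1) * ln 2 \<le> exp ((\<delta> - 1) * ln 2)" by (rule exp_ge_add_one_self)
  also have "\<dots> = ?q" by (simp add: powr_def)
  finally have 1: "1 + (\<delta> - 1) * ln 2 \<le> ?q" .
  have "ln 2 \<le> (1::real)" using ln_le_minus_one[of 2] by simp
  then have "(\<delta> - 1) * 1 \<le> (\<delta> - 1) * ln 2" using assms by (intro mult_left_mono_neg) auto
  with 1 have "\<delta> \<le> ?q" by simp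
  then have "1 / (1 - \<delta>) \<le> 1 / (1 - ?q)" using q assms by (intro divide_left_mono) auto
  moreover have "(\<Sum>k. ennreal (?q ^ k)) = ennreal (1 / (1 - ?q))"
    using q by (intro suminf_ennreal_eq geometric_sums) auto
  ultimately show ?thesis by (simp add: ennreal_leI)
qed

text \<open>The substitution \<open>y = x + z\<close>, with the increment as the outer variable.\<close>
lemma double_integral_eq_increments:
  fixes f :: "'a::euclidean_space \<Rightarrow> real" and K :: "'a \<Rightarrow> ennreal"
  assumes [measurable]: "f \<in> borel_measurable borel" "R \<in> sets borel" "K \<in> borel_measurable borel"
  shows "(\<integral>\<^sup>+x\<in>R. (\<integral>\<^sup>+y\<in>R. ennreal \<bar>f x - f y\<bar> * K (y - x) \<partial>lborel) \<partial>lborel) =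
     (\<integral>\<^sup>+z. K z * (\<integral>\<^sup>+x. indicator R x * indicator R (x + z) * ennreal \<bar>f (x + z) - f x\<bar> \<partial>lborel) \<partial>lborel)"
proof -
  have "(\<integral>\<^sup>+y\<in>R. ennreal \<bar>f x - f y\<bar> * K (y - x) \<partial>lborel)
     = (\<integral>\<^sup>+z. ennreal \<bar>f x - f (x + z)\<bar> * K z * indicator R (x + z) \<partial>lborel)" for x
    by (subst nn_integral_lborel_shift[of _ x, symmetric]) (auto simp: algebra_simps)
  then have "(\<integral>\<^sup>+x\<in>R. (\<integral>\<^sup>+y\<in>R. ennreal \<bar>f x - f y\<bar> * K (y - x) \<partial>lborel) \<partial>lborel)
      = (\<integral>\<^sup>+x. (\<integral>\<^sup>+z. K z * (indicator R x * indicator R (x + z) * ennreal \<bar>f (x + z) - f x\<bar>) \<partial>lborel) \<partial>lborel)"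
    by (simp add: nn_integral_multc[symmetric] nn_integral_cmult[symmetric] mult_ac abs_minus_commute)
  also have "\<dots> = (\<integral>\<^sup>+z. (\<integral>\<^sup>+x. K z * (indicator R x * indicator R (x + z) * ennreal \<bar>f (x + z) - f x\<bar>) \<partial>lborel) \<partial>lborel)"
    by (rule lborel_pair.Fubini') measurable
  also have "\<dots> = (\<integral>\<^sup>+z. K z * (\<integral>\<^sup>+x. indicator R x * indicator R (x + z) * ennreal \<bar>f (x + z) - f x\<bar> \<partial>lborel) \<partial>lborel)"
    by (intro nn_integral_cong nn_integral_cmult) measurable
  finally show ?thesis .
qed

text \<open>The left-hand side is the oscillation at scale \<open>d\<close>, hence by doubling at most \<open>2\<^sup>k\<^sup>(\<^sup>n\<^sup>+\<^sup>1\<^sup>)\<close> times the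
  oscillation at scale \<open>d / 2\<^sup>k\<close>, for every \<open>k\<close>.  Weighting scale \<open>k\<close> by \<open>(d / 2\<^sup>k)\<^sup>-\<^sup>n\<^sup>-\<^sup>\<delta>\<close> and summing
  turns the oscillations into the fractional energy, while the lower bounds add up to a geometric
  series with ratio \<open>2 powr (\<delta> - 1)\<close>.\<close>
proposition fractional_Poincare_convex:
  fixes f :: "'a::euclidean_space \<Rightarrow> real" and \<delta> :: real
  assumes [measurable]: "f \<in> borel_measurable borel" "R \<in> sets borel" and R: "convex R"
    and d: "0 < d" "\<And>x y. x \<in> R \<Longrightarrow> y \<in> R \<Longrightarrow> norm (x - y) \<le> d" and \<delta>: "0 \<le> \<delta>" "\<delta> < 1"
  shows "(\<integral>\<^sup>+x\<in>R. (\<integral>\<^sup>+y\<in>R. ennreal \<bar>f x - f y\<bar> \<partial>lborel) \<partial>lborel)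
    \<le> ennreal (2 * (1 - \<delta>) * d powr (DIM('a) + \<delta>)) *
       (\<integral>\<^sup>+x\<in>R. (\<integral>\<^sup>+y\<in>R. ennreal (\<bar>f x - f y\<bar> / norm (x - y) powr (DIM('a) + \<delta>)) \<partial>lborel) \<partial>lborel)"
    (is "?A \<le> _ * ?J")
proof -
  have cb[measurable]: "cball (0::'a) r \<in> sets borel" for r by simp
  define s where "s = DIM('a) + \<delta>"
  have s1: "1 \<le> s" using DIM_positive[where 'a='a] \<delta> by (auto simp: s_def simp del: DIM_positive)
  define H where "H z = (\<integral>\<^sup>+x. indicator R x * indicator R (x + z) * ennreal \<bar>f (x + z) - f x\<bar> \<partial>lborel)" for z
  have H[measurable]: "H \<in> borel_measurable borel"
    unfolding H_def by measurable
  have H0: "H z = 0" if "d < norm z" for z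
  proof -
    have "indicator R x * indicator R (x + z) * ennreal \<bar>f (x + z) - f x\<bar> = 0" for x
      using d(2)[of "x + z" x] that by (auto simp: indicator_def)
    then show ?thesis unfolding H_def by (simp only: nn_integral_const mult_zero_left)
  qed
  have "?A = (\<integral>\<^sup>+z. 1 * H z \<partial>lborel)"
    using double_integral_eq_increments[of f R "\<lambda>_. 1"] by (simp add: H_def)
  also have "\<dots> = (\<integral>\<^sup>+z. indicator (cball 0 d) z * H z \<partial>lborel)"
    using H0 by (intro nn_integral_cong) (auto simp: indicator_def not_le)
  finally have A: "?A = oscillation R f d"
    by (simp add: oscillation_def H_def)
  have scale: "ennreal (d powr - s) * ennreal ((2 powr (\<delta> - 1)) ^ k) * ?A
      \<le> ennreal ((d / 2 ^ k) powr - s) * oscillation R f (d / 2 ^ k)" for k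
  proof -
    have "(d powr - s * (2 powr (\<delta> - 1)) ^ k) * 2 ^ (k * (DIM('a) + 1)) = (d / 2 ^ k) powr - s"
    proof -
      have "(2 powr (\<delta> - 1)) ^ k = (2::real) powr (k * (\<delta> - 1))"
        by (simp add: powr_realpow[symmetric] powr_powr mult.commute)
      moreover have "2 ^ (k * (DIM('a) + 1)) = (2::real) powr (k * (DIM('a) + 1))"
        by (subst powr_realpow[symmetric]) auto
      ultimately have "(2 powr (\<delta> - 1)) ^ k * 2 ^ (k * (DIM('a) + 1)) = (2::real) powr (k * (\<delta> - 1) + k * (DIM('a) + 1))"
        by (simp add: powr_add)
      also have "k * (\<delta> - 1) + k * (DIM('a) + 1) = k * s" by (simp add: s_def algebra_simps)
      also have "(2::real) powr (k * s) = (1 / 2 ^ k) powr - s"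
      proof -
        have "(1 / 2 ^ k :: real) = 2 powr - real k" by (simp add: powr_minus powr_realpow divide_inverse)
        then show ?thesis by (simp add: powr_powr)
      qed
      finally show ?thesis
        using d powr_mult[of d "1 / 2 ^ k" "- s"] by (simp add: mult.assoc)
    qed
    then have eq: "ennreal (d powr - s) * ennreal ((2 powr (\<delta> - 1)) ^ k) * ennreal (2 ^ (k * (DIM('a) + 1)))
        = ennreal ((d / 2 ^ k) powr - s)"
      by (simp add: ennreal_mult'[symmetric])
    show ?thesis
      unfolding A eq[symmetric] mult.assoc
      by (intro mult_left_mono oscillation_scales) (auto intro: R)
  qed
  have "ennreal (d powr - s) * ennreal (1 / (1 - \<delta>)) * ?A
      \<le> ennreal (d powr - s) * (\<Sum>k. ennreal ((2 powr (\<delta> - 1)) ^ k)) * ?A"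
    by (intro mult_right_mono mult_left_mono geometric_scales \<delta>) auto
  also have "\<dots> = (\<Sum>k. ennreal (d powr - s) * ennreal ((2 powr (\<delta> - 1)) ^ k) * ?A)"
    by simp
  also have "\<dots> \<le> (\<Sum>k. ennreal ((d / 2 ^ k) powr - s) * oscillation R f (d / 2 ^ k))"
    by (intro suminf_le scale) auto
  also have "\<dots> = (\<Sum>k. \<integral>\<^sup>+z. ennreal ((d / 2 ^ k) powr - s) * (indicator (cball 0 (d / 2 ^ k)) z * H z) \<partial>lborel)"
    unfolding oscillation_def H_def[symmetric] by (subst nn_integral_cmult) auto
  also have "\<dots> = (\<integral>\<^sup>+z. (\<Sum>k. ennreal ((d / 2 ^ k) powr - s) * (indicator (cball 0 (d / 2 ^ k)) z * H z)) \<partial>lborel)"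
    by (rule nn_integral_suminf[symmetric]) measurable
  also have "\<dots> \<le> (\<integral>\<^sup>+z. ennreal (2 * norm z powr - s) * H z \<partial>lborel)"
  proof (rule nn_integral_mono)
    fix z :: 'a
    show "(\<Sum>k. ennreal ((d / 2 ^ k) powr - s) * (indicator (cball 0 (d / 2 ^ k)) z * H z))
        \<le> ennreal (2 * norm z powr - s) * H z"
    proof (cases "z = 0")
      case True
      then show ?thesis by (simp add: H_def)
    next
      case False
      have "(\<Sum>k. ennreal ((d / 2 ^ k) powr - s) * (indicator (cball 0 (d / 2 ^ k)) z * H z))
        = (\<Sum>k. ennreal ((d / 2 ^ k) powr - s) * indicator {..d / 2 ^ k} (norm z)) * H z"
        by (simp add: mult.assoc[symmetric] indicator_def)
      also have "\<dots> \<le> ennreal (2 * norm z powr - s) * H z"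
        using False d s1 by (intro mult_right_mono dyadic_kernel_sum) auto
      finally show ?thesis .
    qed
  qed
  also have "\<dots> = 2 * (\<integral>\<^sup>+z. ennreal (norm z powr - s) * H z \<partial>lborel)"
    by (subst nn_integral_cmult[symmetric]) (auto simp: ennreal_mult' mult.assoc)
  also have "(\<integral>\<^sup>+z. ennreal (norm z powr - s) * H z \<partial>lborel) =
      (\<integral>\<^sup>+x\<in>R. (\<integral>\<^sup>+y\<in>R. ennreal \<bar>f x - f y\<bar> * ennreal (norm (y - x) powr - s) \<partial>lborel) \<partial>lborel)"
    unfolding H_def by (rule double_integral_eq_increments[symmetric]) auto
  also have "\<dots> = ?J"
  proof -
    have "ennreal \<bar>f x - f y\<bar> * ennreal (norm (y - x) powr - s) = ennreal (\<bar>f x - f y\<bar> / norm (x - y) powr s)" for x y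
      by (subst ennreal_mult'[symmetric]) (auto simp: powr_minus divide_inverse norm_minus_commute)
    then show ?thesis by (simp only: s_def)
  qed
  finally have fin: "ennreal (d powr - s) * ennreal (1 / (1 - \<delta>)) * ?A \<le> 2 * ?J" .
  have "d powr s * (1 - \<delta>) * (d powr - s * (1 / (1 - \<delta>))) = 1"
    using d \<delta> by (simp add: powr_minus)
  then have one: "ennreal (d powr s * (1 - \<delta>)) * (ennreal (d powr - s) * ennreal (1 / (1 - \<delta>))) = 1"
    using \<delta> by (simp add: ennreal_mult'[symmetric] ennreal_mult''[symmetric] flip: ennreal_1)
  have "?A = (ennreal (d powr s * (1 - \<delta>)) * (ennreal (d powr - s) * ennreal (1 / (1 - \<delta>)))) * ?A"
    unfolding one by (rule mult_1[symmetric])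
  also have "\<dots> = ennreal (d powr s * (1 - \<delta>)) * (ennreal (d powr - s) * ennreal (1 / (1 - \<delta>)) * ?A)"
    by (simp only: mult.assoc)
  also have "\<dots> \<le> ennreal (d powr s * (1 - \<delta>)) * (2 * ?J)"
    using fin by (intro mult_left_mono) auto
  also have "\<dots> = ennreal (2 * (1 - \<delta>) * d powr s) * ?J"
  proof -
    have "ennreal (2 * (1 - \<delta>) * d powr s) = ennreal (d powr s * (1 - \<delta>)) * ennreal 2"
      using \<delta> by (subst ennreal_mult'[symmetric]) (auto simp: mult_ac)
    then show ?thesis by (simp add: mult.assoc)
  qed
  finally show ?thesis by (simp add: s_def)
qed

section \<open>Half-open cubes and dyadic grids\<close>

text \<open>Half-open, so that the dyadic subcubes of a cube partition it exactly.\<close>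
definition half_open_cube :: "'a::euclidean_space \<Rightarrow> real \<Rightarrow> 'a set" where
  "half_open_cube c r = {y. \<forall>i\<in>Basis. c \<bullet> i \<le> y \<bullet> i \<and> y \<bullet> i < c \<bullet> i + r}"

lemma half_open_cube_bounds:
  "box c (c + r *\<^sub>R One) \<subseteq> half_open_cube c r" "half_open_cube c r \<subseteq> cbox c (c + r *\<^sub>R One)"
  by (auto simp: half_open_cube_def mem_box inner_add_left less_imp_le)

lemma half_open_cube_measurable [measurable]: "half_open_cube c r \<in> sets borel"
  unfolding half_open_cube_def by measurable

lemma emeasure_half_open_cube:
  fixes c :: "'a::euclidean_space"
  assumes r: "0 \<le> r"
  shows "emeasure lborel (half_open_cube c r) = ennreal (r ^ DIM('a))"
proof (rule antisym)
  have c: "emeasure lborel (cbox c (c + r *\<^sub>R One)) = ennreal (r ^ DIM('a))"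
    using r by (subst emeasure_lborel_cbox) (auto simp: inner_add_left inner_diff_left)
  have b: "emeasure lborel (box c (c + r *\<^sub>R One)) = ennreal (r ^ DIM('a))"
    using r by (subst emeasure_lborel_box) (auto simp: inner_add_left inner_diff_left)
  show "emeasure lborel (half_open_cube c r) \<le> ennreal (r ^ DIM('a))"
    unfolding c[symmetric] by (intro emeasure_mono half_open_cube_bounds) auto
  show "ennreal (r ^ DIM('a)) \<le> emeasure lborel (half_open_cube c r)"
    unfolding b[symmetric] by (intro emeasure_mono half_open_cube_bounds) auto
qed

lemma convex_half_open_cube: "convex (half_open_cube c r)"
proof -
  have "half_open_cube c r = (\<Inter>i\<in>Basis. {y. i \<bullet> y \<ge> c \<bullet> i} \<inter> {y. i \<bullet> y < c \<bullet> i + r})"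
    by (auto simp: half_open_cube_def inner_commute)
  then show ?thesis
    by (auto intro!: convex_INT convex_Int convex_halfspace_ge convex_halfspace_lt)
qed

lemma norm_diff_half_open_cube:
  fixes c :: "'a::euclidean_space" and r :: real
  assumes "x \<in> half_open_cube c r" "y \<in> half_open_cube c r"
  shows "norm (x - y) \<le> DIM('a) * r"
proof -
  have "norm (x - y) \<le> (\<Sum>i\<in>Basis. \<bar>(x - y) \<bullet> i\<bar>)" by (rule norm_le_l1)
  also have "\<dots> \<le> (\<Sum>i\<in>(Basis::'a set). (r::real))"
  proof (rule sum_mono)
    fix i :: 'a assume "i \<in> Basis"
    then show "\<bar>(x - y) \<bullet> i\<bar> \<le> r"
      using assms unfolding half_open_cube_def inner_diff_left by fastforce
  qed
  finally show ?thesis by simp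
qed

lemma emeasure_countable_disjoint_Union:
  assumes "countable D" "disjoint D" "D \<subseteq> sets M"
  shows "emeasure M (\<Union>D) = (\<integral>\<^sup>+R. emeasure M R \<partial>count_space D)"
proof -
  have "emeasure M (\<Union>((\<lambda>R. R) ` D)) = (\<integral>\<^sup>+R. emeasure M R \<partial>count_space D)"
    using assms by (intro emeasure_UN_countable) (auto simp: disjoint_def disjoint_family_on_def)
  then show ?thesis by simp
qed

locale dyadic_grid =
  fixes a :: "'a::euclidean_space" and l :: real
  assumes l: "0 < l"
begin

text \<open>The dyadic cube of side \<open>l / 2\<^sup>k\<close> containing \<open>x\<close>, in the grid with one corner at \<open>a\<close>.  Cells are
  classes of the relation of having equal integer parts, which makes two cells of equal level visibly
  equal or disjoint.\<close>
definition cell :: "nat \<Rightarrow> 'a \<Rightarrow> 'a set" where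
  "cell k x = {y. \<forall>i\<in>Basis. \<lfloor>(y \<bullet> i - a \<bullet> i) * 2 ^ k / l\<rfloor> = \<lfloor>(x \<bullet> i - a \<bullet> i) * 2 ^ k / l\<rfloor>}"

lemma mem_cell [simp]: "x \<in> cell k x"
  by (simp add: cell_def)

lemma cell_eq_iff: "cell k y = cell k x \<longleftrightarrow> y \<in> cell k x"
  by (auto simp: cell_def)

lemma cell_antimono:
  assumes "j \<le> k" shows "cell k x \<subseteq> cell j x"
  using assms
proof (induction rule: dec_induct)
  case (step k)
  \<comment> \<open>The index of a cell at level \<open>k\<close> is half of the index of its children, rounded down.\<close>
  have half: "\<lfloor>t\<rfloor> = \<lfloor>2 * t\<rfloor> div 2" for t :: real
    using floor_divide_real_eq_div[of 2 "2 * t"] by simp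
  have "cell (Suc k) x \<subseteq> cell k x"
  proof
    fix y assume y: "y \<in> cell (Suc k) x"
    show "y \<in> cell k x"
      unfolding cell_def
    proof (intro CollectI ballI)
      fix i :: 'a assume "i \<in> Basis"
      then have "\<lfloor>2 * ((y \<bullet> i - a \<bullet> i) * 2 ^ k / l)\<rfloor> = \<lfloor>2 * ((x \<bullet> i - a \<bullet> i) * 2 ^ k / l)\<rfloor>"
        using y by (simp add: cell_def mult_ac)
      then show "\<lfloor>(y \<bullet> i - a \<bullet> i) * 2 ^ k / l\<rfloor> = \<lfloor>(x \<bullet> i - a \<bullet> i) * 2 ^ k / l\<rfloor>"
        by (subst (1 2) half) simp
    qed
  qed
  then show ?case using step by blast
qed simp

lemma cell_0: "cell 0 a = half_open_cube a l"
  using l by (auto simp: cell_def half_open_cube_def floor_eq_iff field_simps)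

lemma cell_half_open_cube: "\<exists>c. cell k x = half_open_cube c (l / 2 ^ k)"
proof -
  define m where "m i = real_of_int \<lfloor>(x \<bullet> i - a \<bullet> i) * 2 ^ k / l\<rfloor>" for i
  define c where "c = (\<Sum>i\<in>Basis. (a \<bullet> i + m i * (l / 2 ^ k)) *\<^sub>R i)"
  have c: "c \<bullet> i = a \<bullet> i + m i * (l / 2 ^ k)" if "i \<in> Basis" for i
    using that by (simp add: c_def)
  have "y \<in> cell k x \<longleftrightarrow> y \<in> half_open_cube c (l / 2 ^ k)" for y
  proof -
    have "\<lfloor>(y \<bullet> i - a \<bullet> i) * 2 ^ k / l\<rfloor> = \<lfloor>(x \<bullet> i - a \<bullet> i) * 2 ^ k / l\<rfloor> \<longleftrightarrow>
       c \<bullet> i \<le> y \<bullet> i \<and> y \<bullet> i < c \<bullet> i + l / 2 ^ k" if "i \<in> Basis" for i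
      unfolding floor_eq_iff c[OF that] m_def using l by (simp add: divide_simps) (simp add: algebra_simps)
    then show ?thesis by (simp add: cell_def half_open_cube_def)
  qed
  then show ?thesis by blast
qed

lemma cell_measurable [measurable]: "cell k x \<in> sets borel"
  using cell_half_open_cube[of k x] by auto

lemma emeasure_cell: "emeasure lborel (cell k x) = ennreal ((l / 2 ^ k) ^ DIM('a))"
  using cell_half_open_cube[of k x] l by (auto simp: emeasure_half_open_cube)

lemma norm_diff_cell:
  "y \<in> cell k x \<Longrightarrow> z \<in> cell k x \<Longrightarrow> norm (y - z) \<le> DIM('a) * (l / 2 ^ k)"
  using cell_half_open_cube[of k x] norm_diff_half_open_cube[of y _ "l / 2 ^ k" z] by auto

lemma countable_cells: "countable (range (\<lambda>(k, x). cell k x))"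
proof -
  have "range (cell k) \<subseteq> (\<lambda>m. {y. \<forall>i\<in>Basis. \<lfloor>(y \<bullet> i - a \<bullet> i) * 2 ^ k / l\<rfloor> = m i}) ` (Basis \<rightarrow>\<^sub>E (UNIV :: int set))" for k
  proof safe
    fix x
    show "cell k x \<in> (\<lambda>m. {y. \<forall>i\<in>Basis. \<lfloor>(y \<bullet> i - a \<bullet> i) * 2 ^ k / l\<rfloor> = m i}) ` (Basis \<rightarrow>\<^sub>E (UNIV :: int set))"
      by (rule image_eqI[of _ _ "\<lambda>i\<in>Basis. \<lfloor>(x \<bullet> i - a \<bullet> i) * 2 ^ k / l\<rfloor>"]) (auto simp: cell_def)
  qed
  then have "countable (range (cell k))" for k
    by (rule countable_subset) (intro countable_image countable_PiE, auto)
  then have "countable (\<Union>k. range (cell k))" by auto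
  then show ?thesis by (rule countable_subset[rotated]) auto
qed

lemma small_cell_in_open:
  assumes "open U" "x \<in> U" shows "\<exists>k. cell k x \<subseteq> U"
proof -
  obtain e where e: "0 < e" "ball x e \<subseteq> U" using assms by (auto simp: open_contains_ball)
  obtain k where k: "DIM('a) * l / e < 2 ^ k" using real_arch_pow[of 2 "DIM('a) * l / e"] by auto
  then have "DIM('a) * (l / 2 ^ k) < e" using e l by (simp add: field_simps)
  then have "cell k x \<subseteq> ball x e"
    using norm_diff_cell[of x k x] by (force simp: dist_norm)
  then show ?thesis using e by blast
qed

text \<open>The largest cells of \<open>F\<close>: each point of the union chooses the cell of least level around it.
  If two chosen cells meet, the larger one is also a candidate for the point that chose the smaller
  one, so they have the same level.\<close>
lemma maximal_cells:
  assumes "\<And>R. R \<in> F \<Longrightarrow> \<exists>k x. R = cell k x"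
  obtains D where "D \<subseteq> F" "countable D" "disjoint D" "\<Union>D = \<Union>F"
proof -
  define K where "K x = (LEAST k. cell k x \<in> F)" for x
  define D where "D = {cell (K x) x | x. x \<in> \<Union>F}"
  have ex: "\<exists>k. cell k x \<in> F" if "x \<in> \<Union>F" for x
  proof -
    obtain R where R: "R \<in> F" "x \<in> R" using \<open>x \<in> \<Union>F\<close> by blast
    with assms obtain k y where "R = cell k y" by blast
    with R show ?thesis by (metis cell_eq_iff)
  qed
  have KF: "cell (K x) x \<in> F" if "x \<in> \<Union>F" for x
    unfolding K_def by (rule LeastI_ex) (rule ex[OF that])
  have le: "cell (K x) x = cell (K y) y"
    if "x \<in> \<Union>F" "y \<in> \<Union>F" "z \<in> cell (K x) x" "z \<in> cell (K y) y" "K x \<le> K y" for x y z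
  proof -
    have "z \<in> cell (K x) y" using that cell_antimono by blast
    then have eq: "cell (K x) x = cell (K x) y" using that by (metis cell_eq_iff)
    then have "K y \<le> K x" unfolding K_def[of y] using KF[OF that(1)] by (intro Least_le) simp
    then show ?thesis using eq that(5) by simp
  qed
  show ?thesis
  proof
    show "D \<subseteq> F" using KF by (auto simp: D_def)
    show "countable D" by (rule countable_subset[OF _ countable_cells]) (auto simp: D_def)
    show "disjoint D"
      unfolding disjoint_def D_def using le by (auto, (metis nat_le_linear)+)
    show "\<Union>D = \<Union>F" using \<open>D \<subseteq> F\<close> mem_cell by (fastforce simp: D_def)
  qed
qed

text \<open>A form of the Lebesgue density theorem.  Let \<open>N\<close> be the bounded part of the set of exceptions, and
  cover \<open>N\<close> by disjoint cells inside an open set \<open>U\<close> of measure at most \<open>|N| + \<epsilon>\<close>.  Every cell that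
  meets \<open>N\<close> is filled by \<open>E\<close>, hence by \<open>N\<close>, to at most one half, so \<open>2 |N| \<le> |U|\<close>; letting \<open>\<epsilon>\<close> tend to
  \<open>0\<close> gives \<open>|N| = 0\<close>.\<close>
lemma AE_dense_cell:
  assumes E[measurable]: "E \<in> sets borel"
  shows "AE x in lborel. x \<in> E \<longrightarrow>
    (\<exists>k. emeasure lborel (cell k x) < 2 * emeasure lborel (E \<inter> cell k x))"
proof -
  define B where "B = {R. \<exists>k x. R = cell k x \<and> emeasure lborel R < 2 * emeasure lborel (E \<inter> R)}"
  have cB: "countable B" by (rule countable_subset[OF _ countable_cells]) (auto simp: B_def)
  have Bs[measurable]: "\<Union>B \<in> sets borel"
    using cB by (intro sets.countable_Union) (auto simp: B_def)
  have null: "(E - \<Union>B) \<inter> ball 0 r \<in> null_sets lborel" for r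
  proof -
    define N where "N = (E - \<Union>B) \<inter> ball 0 r"
    have N[measurable]: "N \<in> sets borel" unfolding N_def by measurable
    have fin: "emeasure lborel N < \<infinity>"
      by (rule le_less_trans[OF emeasure_mono emeasure_lborel_ball_finite[of 0 r]]) (auto simp: N_def)
    have "2 * emeasure lborel N \<le> emeasure lborel N + ennreal e" if e: "0 < e" for e
    proof -
      obtain U where U: "open U" "N \<subseteq> U" "emeasure lborel (U - N) < e"
        using outer_regular_lborel[of N e] e by auto
      define F where "F = {R. \<exists>k x. R = cell k x \<and> R \<subseteq> U \<and> R \<inter> N \<noteq> {}}"
      obtain D where D: "D \<subseteq> F" "countable D" "disjoint D" "\<Union>D = \<Union>F"
        using maximal_cells[of F] by (auto simp: F_def)
      have Ds: "D \<subseteq> sets borel" using D(1) by (auto simp: F_def)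
      have UD[measurable]: "\<Union>D \<in> sets borel" using D(2) Ds by (intro sets.countable_Union) auto
      have NF: "N \<subseteq> \<Union>F"
      proof
        fix x assume x: "x \<in> N"
        with U obtain k where "cell k x \<subseteq> U" using small_cell_in_open by blast
        then show "x \<in> \<Union>F" using x mem_cell[of x k] unfolding F_def by blast
      qed
      have half: "2 * emeasure lborel (N \<inter> R) \<le> emeasure lborel R" if RD: "R \<in> D" for R
      proof -
        obtain k x where R: "R = cell k x" "R \<inter> N \<noteq> {}" using RD D(1) unfolding F_def by blast
        then have "R \<notin> B" by (auto simp: N_def)
        then have "2 * emeasure lborel (E \<inter> R) \<le> emeasure lborel R" using R by (auto simp: B_def not_less)
        moreover have "emeasure lborel (N \<inter> R) \<le> emeasure lborel (E \<inter> R)"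
          using R by (intro emeasure_mono) (auto simp: N_def)
        ultimately show ?thesis by (meson mult_left_mono order_trans zero_le)
      qed
      have "emeasure lborel N = emeasure (density lborel (indicator N)) (\<Union>D)"
      proof -
        have "N \<inter> \<Union>D = N" using NF D(4) by auto
        then show ?thesis by (simp add: emeasure_density indicator_inter_arith[symmetric])
      qed
      also have "\<dots> = (\<integral>\<^sup>+R. emeasure (density lborel (indicator N)) R \<partial>count_space D)"
        using D Ds by (intro emeasure_countable_disjoint_Union) auto
      also have "\<dots> = (\<integral>\<^sup>+R. emeasure lborel (N \<inter> R) \<partial>count_space D)"
        using Ds by (intro nn_integral_cong) (auto simp: emeasure_density indicator_inter_arith[symmetric])
      finally have "2 * emeasure lborel N = (\<integral>\<^sup>+R. 2 * emeasure lborel (N \<inter> R) \<partial>count_space D)"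
        by (simp add: nn_integral_cmult)
      also have "\<dots> \<le> (\<integral>\<^sup>+R. emeasure lborel R \<partial>count_space D)"
        using half by (intro nn_integral_mono) auto
      also have "\<dots> = emeasure lborel (\<Union>D)"
        using D Ds by (intro emeasure_countable_disjoint_Union[symmetric]) auto
      also have "\<dots> \<le> emeasure lborel U"
        using D U(1) by (intro emeasure_mono) (auto simp: F_def)
      also have "\<dots> = emeasure lborel (N \<union> (U - N))" using U(2) by (intro arg_cong[where f="emeasure lborel"]) auto
      also have "\<dots> \<le> emeasure lborel N + emeasure lborel (U - N)"
        using U(1) by (intro emeasure_subadditive) auto
      also have "\<dots> \<le> emeasure lborel N + ennreal e"
        using U(3) by (intro add_left_mono) auto
      finally show ?thesis .
    qed
    then have "2 * emeasure lborel N \<le> emeasure lborel N"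
      by (rule ennreal_le_epsilon[rotated])
    then have "emeasure lborel N = 0" using fin
      by (cases "emeasure lborel N") (auto simp: ennreal_mult'[symmetric] simp flip: ennreal_numeral)
    then show ?thesis unfolding N_def[symmetric] by auto
  qed
  have "(\<Union>r::nat. (E - \<Union>B) \<inter> ball 0 (real r)) \<in> null_sets lborel"
    using null by (intro null_sets_UN)
  moreover have "(\<Union>r::nat. (E - \<Union>B) \<inter> ball 0 (real r)) = E - \<Union>B"
    using reals_Archimedean2 by auto
  ultimately have "E - \<Union>B \<in> null_sets lborel" by (simp only:)
  then have "AE x in lborel. x \<notin> E - \<Union>B" by (rule AE_not_in)
  then show ?thesis
  proof eventually_elim
    case (elim x)
    show ?case
    proof
      assume "x \<in> E"
      with elim obtain k y where "x \<in> cell k y" "emeasure lborel (cell k y) < 2 * emeasure lborel (E \<inter> cell k y)"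
        by (auto simp: B_def)
      then show "\<exists>k. emeasure lborel (cell k x) < 2 * emeasure lborel (E \<inter> cell k x)"
        by (metis cell_eq_iff)
    qed
  qed
qed

end

section \<open>Powers of extended nonnegative numbers\<close>

lemma ennreal_powr_ennreal: "0 \<le> x \<Longrightarrow> ennreal_powr (ennreal x) p = ennreal (x powr p)"
  by (simp add: ennreal_powr_def)

lemma ennreal_powr_top [simp]: "ennreal_powr top p = top"
  by (simp add: ennreal_powr_def)

lemma ennreal_powr_0 [simp]: "ennreal_powr 0 p = 0"
  by (simp add: ennreal_powr_def)

lemma ennreal_powr_mono: "a \<le> b \<Longrightarrow> 0 < p \<Longrightarrow> ennreal_powr a p \<le> ennreal_powr b p"
  by (cases a; cases b) (auto simp: ennreal_powr_ennreal top_unique intro!: ennreal_leI powr_mono2)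

lemma ennreal_powr_mult: "ennreal_powr (a * b) p = ennreal_powr a p * ennreal_powr b p"
proof -
  have top: "ennreal_powr (top * c) p = top * ennreal_powr c p" for c
    by (cases "c = 0"; cases c) (auto simp: ennreal_top_mult ennreal_powr_ennreal)
  show ?thesis
    using top[of a] top[of b]
    by (cases a; cases b) (auto simp: ennreal_powr_ennreal ennreal_mult'[symmetric] powr_mult mult.commute)
qed

lemma ennreal_powr_powr: "ennreal_powr (ennreal_powr a p) q = ennreal_powr a (p * q)"
  by (cases a) (auto simp: ennreal_powr_ennreal powr_powr)

lemma ennreal_powr_1 [simp]: "ennreal_powr a 1 = a"
  by (cases a) (auto simp: ennreal_powr_ennreal)

lemma measurable_ennreal_powr [measurable]: "(\<lambda>x. ennreal_powr x p) \<in> borel_measurable borel"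
  unfolding ennreal_powr_def by measurable

lemma ennreal_powr_le_iff:
  assumes "0 < p"
  shows "ennreal_powr a p \<le> b \<longleftrightarrow> a \<le> ennreal_powr b (1 / p)"
  using ennreal_powr_mono[of "ennreal_powr a p" b "1 / p"] ennreal_powr_mono[of a "ennreal_powr b (1 / p)" p] assms
  by (auto simp: ennreal_powr_powr)

text \<open>With \<open>S\<close> the total sum, every term satisfies \<open>f i \<le> S powr (1 - p) * f i powr p\<close>; summing over \<open>i\<close> and
  dividing by \<open>S powr (1 - p)\<close> gives the claim.\<close>
lemma ennreal_powr_subadditive:
  fixes f :: "'b \<Rightarrow> ennreal"
  assumes p: "0 < p" "p \<le> 1" and fin: "(\<integral>\<^sup>+i. f i \<partial>count_space D) < \<infinity>"
  shows "ennreal_powr (\<integral>\<^sup>+i. f i \<partial>count_space D) p \<le> (\<integral>\<^sup>+i. ennreal_powr (f i) p \<partial>count_space D)"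
proof (cases "(\<integral>\<^sup>+i. f i \<partial>count_space D) = 0")
  case False
  define S where "S = (\<integral>\<^sup>+i. f i \<partial>count_space D)"
  obtain s where s: "S = ennreal s" "0 < s"
    using fin False unfolding S_def[symmetric] by (cases S) (auto simp: order_less_le)
  have le: "f i \<le> ennreal (s powr (1 - p)) * ennreal_powr (f i) p" if "i \<in> D" for i
  proof -
    have "f i \<le> S" unfolding S_def by (rule nn_integral_ge_point[OF that])
    then obtain t where t: "f i = ennreal t" "0 \<le> t" "t \<le> s" using s by (cases "f i") (auto simp: top_unique)
    have "t = t powr (1 - p) * t powr p" using t p by (cases "t = 0") (auto simp: powr_add[symmetric])
    also have "\<dots> \<le> s powr (1 - p) * t powr p" using t p by (intro mult_right_mono powr_mono2) auto
    finally show ?thesis using t by (simp add: ennreal_powr_ennreal ennreal_mult'[symmetric] ennreal_leI)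
  qed
  have "ennreal_powr S p = ennreal (s powr (p - 1)) * S"
    using s by (simp add: ennreal_powr_ennreal ennreal_mult'[symmetric] powr_diff)
  also have "S \<le> (\<integral>\<^sup>+i. ennreal (s powr (1 - p)) * ennreal_powr (f i) p \<partial>count_space D)"
    unfolding S_def using le by (intro nn_integral_mono) auto
  also have "\<dots> = ennreal (s powr (1 - p)) * (\<integral>\<^sup>+i. ennreal_powr (f i) p \<partial>count_space D)"
    by (rule nn_integral_cmult) auto
  also have "ennreal (s powr (p - 1)) * \<dots> = (\<integral>\<^sup>+i. ennreal_powr (f i) p \<partial>count_space D)"
    using s by (simp add: mult.assoc[symmetric] ennreal_mult'[symmetric] powr_add[symmetric])
  finally show ?thesis by (simp add: S_def mult_left_mono)
qed simp

lemma two_power_ennreal: "(2::ennreal) ^ k = ennreal (2 ^ k)"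
  by (simp flip: ennreal_power)

section \<open>The weighted isoperimetric inequality\<close>

definition frac_kernel :: "real \<Rightarrow> 'a::euclidean_space \<Rightarrow> 'a \<Rightarrow> ennreal" where
  "frac_kernel \<delta> x y = ennreal (1 / norm (x - y) powr (real DIM('a) + \<delta>))"

lemma measurable_frac_kernel [measurable]:
  "(\<lambda>(x, y). frac_kernel \<delta> x y) \<in> borel_measurable (borel \<Otimes>\<^sub>M borel)"
  unfolding frac_kernel_def by measurable

text \<open>For an indicator function the double integral of the oscillation is at least \<open>|E \<inter> R| |R - E|\<close>, which
  the two density bounds make comparable to \<open>|R|\<^sup>2 = r\<^sup>2\<^sup>n\<close>.  The fractional Poincare inequality with
  diameter bound \<open>n r\<close> then loses the power \<open>r\<^sup>n\<^sup>+\<^sup>\<delta>\<close>.\<close>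
lemma relative_isoperimetric_cube:
  fixes c :: "'a::euclidean_space" and r \<delta> :: real
  assumes [measurable]: "E \<in> sets borel" and r: "0 < r" and \<delta>: "0 \<le> \<delta>" "\<delta> < 1"
  defines "R \<equiv> half_open_cube c r"
  assumes low: "emeasure lborel R \<le> 2 ^ (DIM('a) + 1) * emeasure lborel (E \<inter> R)"
    and up: "2 * emeasure lborel (E \<inter> R) \<le> emeasure lborel R"
  shows "ennreal (r powr (DIM('a) - \<delta>)) \<le> ennreal (2 ^ (DIM('a) + 3) * real DIM('a) ^ (DIM('a) + 1) * (1 - \<delta>)) *
    (\<integral>\<^sup>+x\<in>R. (\<integral>\<^sup>+y\<in>R. ennreal \<bar>indicator E x - indicator E y\<bar> * frac_kernel \<delta> x y \<partial>lborel) \<partial>lborel)"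
    (is "_ \<le> _ * ?J")
proof -
  let ?n = "DIM('a)"
  have [measurable]: "R \<in> sets borel" unfolding R_def by measurable
  have eR: "emeasure lborel R = ennreal (r ^ ?n)" using r by (simp add: R_def emeasure_half_open_cube)
  have "emeasure lborel (E \<inter> R) \<le> emeasure lborel R" "emeasure lborel (R - E) \<le> emeasure lborel R"
    by (auto intro!: emeasure_mono)
  then obtain e e' where e: "emeasure lborel (E \<inter> R) = ennreal e" "0 \<le> e"
    and e': "emeasure lborel (R - E) = ennreal e'" "0 \<le> e'"
    unfolding eR by (cases "emeasure lborel (E \<inter> R)"; cases "emeasure lborel (R - E)") (auto simp: top_unique)
  have "emeasure lborel R = emeasure lborel (E \<inter> R) + emeasure lborel (R - E)"
    by (subst plus_emeasure) (auto intro!: arg_cong[where f="emeasure lborel"])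
  then have sum: "r ^ ?n = e + e'" using e e' r unfolding eR by (simp flip: ennreal_plus)
  have "ennreal (r ^ ?n) \<le> ennreal (2 ^ (?n + 1) * e)"
    using low unfolding eR e two_power_ennreal by (subst ennreal_mult') auto
  then have low': "r ^ ?n \<le> 2 ^ (?n + 1) * e"
    by (subst (asm) ennreal_le_iff) (use e in auto)
  have "ennreal (2 * e) \<le> ennreal (r ^ ?n)"
    using up unfolding eR e by (subst ennreal_mult') auto
  then have up': "2 * e \<le> r ^ ?n"
    by (subst (asm) ennreal_le_iff) (use r in auto)
  have "r ^ ?n * r ^ ?n \<le> (2 ^ (?n + 1) * e) * (2 * e')"
    using low' up' sum e r by (intro mult_mono) auto
  then have key: "r ^ (2 * ?n) \<le> 2 ^ (?n + 2) * (e * e')"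
    by (subst mult_2, subst power_add) (simp add: mult_ac)
  have "ennreal (e * e') = (\<integral>\<^sup>+x. emeasure lborel (R - E) * indicator (E \<inter> R) x \<partial>lborel)"
    using e e' by (subst nn_integral_cmult_indicator) (auto simp: ennreal_mult' mult.commute)
  also have "\<dots> \<le> (\<integral>\<^sup>+x\<in>R. (\<integral>\<^sup>+y\<in>R. ennreal \<bar>indicator E x - indicator E y\<bar> \<partial>lborel) \<partial>lborel)"
  proof (intro nn_integral_mono)
    fix x
    show "emeasure lborel (R - E) * indicator (E \<inter> R) x \<le>
       (\<integral>\<^sup>+y\<in>R. ennreal \<bar>indicator E x - indicator E y\<bar> \<partial>lborel) * indicator R x"
    proof (cases "x \<in> E \<inter> R")
      case True
      then have "(\<integral>\<^sup>+y\<in>R. ennreal \<bar>indicator E x - indicator E y\<bar> \<partial>lborel) = (\<integral>\<^sup>+y. indicator (R - E) y \<partial>lborel)"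
        by (intro nn_integral_cong) (auto simp: indicator_def)
      also have "\<dots> = emeasure lborel (R - E)" by (rule nn_integral_indicator) simp
      finally show ?thesis using True by simp
    qed simp
  qed
  also have "\<dots> \<le> ennreal (2 * (1 - \<delta>) * (?n * r) powr (?n + \<delta>)) *
      (\<integral>\<^sup>+x\<in>R. (\<integral>\<^sup>+y\<in>R. ennreal (\<bar>indicator E x - indicator E y\<bar> / norm (x - y) powr (?n + \<delta>)) \<partial>lborel) \<partial>lborel)"
    using r \<delta> norm_diff_half_open_cube
    by (intro fractional_Poincare_convex) (auto simp: R_def convex_half_open_cube)
  also have "(\<integral>\<^sup>+x\<in>R. (\<integral>\<^sup>+y\<in>R. ennreal (\<bar>indicator E x - indicator E y\<bar> / norm (x - y) powr (?n + \<delta>)) \<partial>lborel) \<partial>lborel) = ?J"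
    by (simp add: frac_kernel_def ennreal_mult'[symmetric])
  finally have main: "ennreal (e * e') \<le> ennreal (2 * (1 - \<delta>) * (?n * r) powr (?n + \<delta>)) * ?J" .
  define P where "P = r powr (- (?n + \<delta>)) * 2 ^ (?n + 2)"
  have P0: "0 \<le> P" by (simp add: P_def)
  have "r powr (?n - \<delta>) = r powr (- (?n + \<delta>)) * r ^ (2 * ?n)"
    using r by (simp add: powr_realpow[symmetric] powr_add[symmetric] algebra_simps)
  also have "\<dots> \<le> P * (e * e')"
    unfolding P_def mult.assoc using key by (intro mult_left_mono) auto
  finally have "ennreal (r powr (?n - \<delta>)) \<le> ennreal P * ennreal (e * e')"
    using P0 by (simp add: ennreal_mult'[symmetric] ennreal_leI)
  also have "\<dots> \<le> ennreal P * (ennreal (2 * (1 - \<delta>) * (?n * r) powr (?n + \<delta>)) * ?J)"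
    by (intro mult_left_mono main) simp
  also have "\<dots> = ennreal (P * (2 * (1 - \<delta>) * (?n * r) powr (?n + \<delta>))) * ?J"
    using P0 by (simp add: ennreal_mult' mult.assoc)
  also have "P * (2 * (1 - \<delta>) * (?n * r) powr (?n + \<delta>)) = 2 ^ (?n + 3) * ?n powr (?n + \<delta>) * (1 - \<delta>)"
  proof -
    have "r powr (- (?n + \<delta>)) * (?n * r) powr (?n + \<delta>) = ?n powr (?n + \<delta>)"
      using r by (simp add: powr_mult powr_add[symmetric])
    then show ?thesis by (simp add: P_def power_add) (simp add: algebra_simps)
  qed
  also have "ennreal (2 ^ (?n + 3) * ?n powr (?n + \<delta>) * (1 - \<delta>)) * ?J \<le> ennreal (2 ^ (?n + 3) * real ?n ^ (?n + 1) * (1 - \<delta>)) * ?J"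
  proof (intro ennreal_leI mult_right_mono mult_left_mono)
    have n1: "1 \<le> real ?n" using DIM_positive[where 'a='a] by linarith
    then have "real ?n powr (?n + \<delta>) \<le> ?n powr real (?n + 1)" using \<delta> by (intro powr_mono) auto
    also have "\<dots> = real ?n ^ (?n + 1)" using n1 by (intro powr_realpow) linarith
    finally show "real ?n powr (?n + \<delta>) \<le> real ?n ^ (?n + 1)" .
  qed (use \<delta> in auto)
  finally show ?thesis .
qed

context dyadic_grid begin

text \<open>Going down the cells around a point of density, consider the parent of the first cell that is filled
  by \<open>E\<close> to more than one half; it exists because \<open>cell 0 a\<close> itself is not so filled.  The parent is filled
  to at most one half, but to at least \<open>2\<^sup>-\<^sup>n\<^sup>-\<^sup>1\<close>, since it is only \<open>2\<^sup>n\<close> times larger than its child.\<close>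
lemma AE_critical_cell:
  assumes E[measurable]: "E \<in> sets borel"
    and small: "2 * emeasure lborel (E \<inter> cell 0 a) \<le> emeasure lborel (cell 0 a)"
  shows "AE x in lborel. x \<in> E \<inter> cell 0 a \<longrightarrow> (\<exists>k.
     emeasure lborel (cell k x) \<le> 2 ^ (DIM('a) + 1) * emeasure lborel (E \<inter> cell k x) \<and>
     2 * emeasure lborel (E \<inter> cell k x) \<le> emeasure lborel (cell k x))"
  using AE_dense_cell[OF E]
proof eventually_elim
  case (elim x)
  show ?case
  proof
    assume x: "x \<in> E \<inter> cell 0 a"
    define k where "k = (LEAST k. emeasure lborel (cell k x) < 2 * emeasure lborel (E \<inter> cell k x))"
    have k: "emeasure lborel (cell k x) < 2 * emeasure lborel (E \<inter> cell k x)"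
      unfolding k_def by (rule LeastI_ex) (use elim x in auto)
    have "cell 0 x = cell 0 a" using x by (simp add: cell_eq_iff)
    then have "k \<noteq> 0" using k small by (metis not_less)
    then obtain j where j: "k = Suc j" by (cases k) auto
    have "\<not> emeasure lborel (cell j x) < 2 * emeasure lborel (E \<inter> cell j x)"
      by (rule not_less_Least) (use j in \<open>simp add: k_def[symmetric]\<close>)
    moreover have "emeasure lborel (cell j x) \<le> 2 ^ (DIM('a) + 1) * emeasure lborel (E \<inter> cell j x)"
    proof -
      have "(l / 2 ^ j) ^ DIM('a) = 2 ^ DIM('a) * (l / 2 ^ k) ^ DIM('a)"
        unfolding power_mult_distrib[symmetric] j by simp
      then have "emeasure lborel (cell j x) = 2 ^ DIM('a) * emeasure lborel (cell k x)"
        using l by (simp add: emeasure_cell ennreal_mult' flip: ennreal_power)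
      also have "\<dots> \<le> 2 ^ DIM('a) * (2 * emeasure lborel (E \<inter> cell k x))"
        using k by (intro mult_left_mono) auto
      also have "\<dots> \<le> 2 ^ DIM('a) * (2 * emeasure lborel (E \<inter> cell j x))"
        using cell_antimono[of j k x] j by (intro mult_left_mono emeasure_mono) auto
      finally show ?thesis by (simp add: mult_ac)
    qed
    ultimately show "\<exists>k. emeasure lborel (cell k x) \<le> 2 ^ (DIM('a) + 1) * emeasure lborel (E \<inter> cell k x) \<and>
     2 * emeasure lborel (E \<inter> cell k x) \<le> emeasure lborel (cell k x)"
      by (auto simp: not_less)
  qed
qed

text \<open>A Borel function below the maximal function of \<open>w\<close>.  Averages over cells are what the stopping-time
  argument produces, and Borel measurability makes Tonelli's theorem applicable.\<close>
definition dyadic_maximal :: "('a \<Rightarrow> ennreal) \<Rightarrow> 'a \<Rightarrow> ennreal" where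
  "dyadic_maximal w x = (SUP k. (\<integral>\<^sup>+y\<in>cell k x. w y \<partial>lborel) / emeasure lborel (cell k x))"

lemma measurable_dyadic_maximal [measurable]:
  assumes [measurable]: "w \<in> borel_measurable borel"
  shows "dyadic_maximal w \<in> borel_measurable borel"
proof -
  have "(\<integral>\<^sup>+y\<in>cell k x. w y \<partial>lborel) =
    (\<integral>\<^sup>+y. (if \<forall>i\<in>Basis. \<lfloor>(y \<bullet> i - a \<bullet> i) * 2 ^ k / l\<rfloor> = \<lfloor>(x \<bullet> i - a \<bullet> i) * 2 ^ k / l\<rfloor> then w y else 0) \<partial>lborel)" for k x
    by (intro nn_integral_cong) (auto simp: cell_def indicator_def)
  then have [measurable]: "(\<lambda>x. \<integral>\<^sup>+y\<in>cell k x. w y \<partial>lborel) \<in> borel_measurable borel" for k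
    by (simp only:) measurable
  show ?thesis
    unfolding dyadic_maximal_def[abs_def] emeasure_cell by measurable
qed

text \<open>On each maximal critical cell \<open>R\<close> the average of \<open>w\<close> is a lower bound for the dyadic maximal function at
  every point of \<open>R\<close>, and the remaining power of the side is controlled by the isoperimetric
  inequality.  The critical cells cover \<open>E\<close> up to a null set, and they are disjoint, so that their
  energies add up to at most the energy of \<open>cell 0 a\<close>.\<close>
lemma weighted_isoperimetric_small:
  fixes \<delta> :: real and w :: "'a \<Rightarrow> ennreal"
  assumes E[measurable]: "E \<in> sets borel" and w[measurable]: "w \<in> borel_measurable borel"
    and \<delta>: "0 \<le> \<delta>" "\<delta> < 1"
    and small: "2 * emeasure lborel (E \<inter> cell 0 a) \<le> emeasure lborel (cell 0 a)"
    and fin: "(\<integral>\<^sup>+x\<in>cell 0 a. w x \<partial>lborel) < \<infinity>"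
  shows "ennreal_powr (\<integral>\<^sup>+x\<in>E \<inter> cell 0 a. w x \<partial>lborel) ((DIM('a) - \<delta>) / DIM('a)) \<le>
    ennreal (2 ^ (DIM('a) + 3) * real DIM('a) ^ (DIM('a) + 1) * (1 - \<delta>)) *
    (\<integral>\<^sup>+x\<in>cell 0 a. (\<integral>\<^sup>+y\<in>cell 0 a. ennreal \<bar>indicator E x - indicator E y\<bar> * frac_kernel \<delta> x y \<partial>lborel)
        * ennreal_powr (dyadic_maximal w x) ((DIM('a) - \<delta>) / DIM('a)) \<partial>lborel)"
proof -
  let ?n = "DIM('a)" and ?Q = "cell 0 a"
  define \<alpha> where "\<alpha> = (?n - \<delta>) / ?n"
  define C where "C = ennreal (2 ^ (?n + 3) * real ?n ^ (?n + 1) * (1 - \<delta>))"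
  have "1 \<le> ?n" using DIM_positive[where 'a='a] by linarith
  then have n1: "1 \<le> real ?n" by (simp only: real_of_nat_ge_one_iff)
  have \<alpha>: "0 < \<alpha>" "\<alpha> \<le> 1"
  proof -
    have "(?n - \<delta>) / ?n \<le> real ?n / ?n" using \<delta> by (intro divide_right_mono) auto
    then show "\<alpha> \<le> 1" using n1 by (simp add: \<alpha>_def)
    show "0 < \<alpha>" unfolding \<alpha>_def using \<delta> n1 by (intro divide_pos_pos) linarith+
  qed
  define h where "h x y = ennreal \<bar>indicator E x - indicator E y\<bar> * frac_kernel \<delta> x y" for x y
  have h[measurable]: "(\<lambda>(x, y). h x y) \<in> borel_measurable (borel \<Otimes>\<^sub>M borel)"
    unfolding h_def by measurable
  define g where "g x = (\<integral>\<^sup>+y\<in>?Q. h x y \<partial>lborel) * ennreal_powr (dyadic_maximal w x) \<alpha>" for x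
  have g[measurable]: "g \<in> borel_measurable borel" unfolding g_def by measurable
  define F where "F = {R. (\<exists>k x. R = cell k x) \<and> R \<subseteq> ?Q \<and>
     emeasure lborel R \<le> 2 ^ (?n + 1) * emeasure lborel (E \<inter> R) \<and> 2 * emeasure lborel (E \<inter> R) \<le> emeasure lborel R}"
  obtain D where D: "D \<subseteq> F" "countable D" "disjoint D" "\<Union>D = \<Union>F"
    using maximal_cells[of F] by (auto simp: F_def)
  have Ds: "D \<subseteq> sets borel" using D(1) by (auto simp: F_def)
  have UD[measurable]: "\<Union>D \<in> sets borel" using D(2) Ds by (intro sets.countable_Union) auto
  have UQ: "\<Union>D \<subseteq> ?Q" using D(1) by (auto simp: F_def)
  have cell_bound: "ennreal_powr (\<integral>\<^sup>+x\<in>R. w x \<partial>lborel) \<alpha> \<le> C * (\<integral>\<^sup>+x\<in>R. g x \<partial>lborel)" if RD: "R \<in> D" for R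
  proof -
    obtain k z where R: "R = cell k z" and RQ: "R \<subseteq> ?Q"
      and low: "emeasure lborel R \<le> 2 ^ (?n + 1) * emeasure lborel (E \<inter> R)"
      and up: "2 * emeasure lborel (E \<inter> R) \<le> emeasure lborel R"
      using RD D(1) unfolding F_def by blast
    have [measurable]: "R \<in> sets borel" by (simp add: R)
    define r where "r = l / 2 ^ k"
    have r: "0 < r" using l by (simp add: r_def)
    define v where "v = (\<integral>\<^sup>+x\<in>R. w x \<partial>lborel) / emeasure lborel R"
    have eR: "emeasure lborel R = ennreal (r ^ ?n)" by (simp add: R emeasure_cell r_def)
    have v: "v \<le> dyadic_maximal w x" if "x \<in> R" for x
    proof -
      have "cell k x = R" using that by (simp add: R cell_eq_iff)
      then show ?thesis unfolding v_def dyadic_maximal_def by (intro SUP_upper2[of k]) auto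
    qed
    obtain c where c: "R = half_open_cube c r" using cell_half_open_cube[of k z] by (auto simp: R r_def)
    have "(\<integral>\<^sup>+x\<in>R. w x \<partial>lborel) = v * ennreal (r ^ ?n)"
      unfolding v_def eR ennreal_divide_times using r by (subst ennreal_divide_self) auto
    moreover have "ennreal_powr (ennreal (r ^ ?n)) \<alpha> = ennreal (r powr (?n - \<delta>))"
      using r n1 by (simp add: ennreal_powr_ennreal powr_realpow[symmetric] powr_powr \<alpha>_def)
    ultimately have "ennreal_powr (\<integral>\<^sup>+x\<in>R. w x \<partial>lborel) \<alpha> = ennreal_powr v \<alpha> * ennreal (r powr (?n - \<delta>))"
      by (simp add: ennreal_powr_mult)
    also have "\<dots> \<le> ennreal_powr v \<alpha> * (C * (\<integral>\<^sup>+x\<in>R. (\<integral>\<^sup>+y\<in>R. h x y \<partial>lborel) \<partial>lborel))"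
      unfolding C_def h_def c using r \<delta> low up
      by (intro mult_left_mono relative_isoperimetric_cube) (auto simp: c)
    also have "\<dots> = C * (\<integral>\<^sup>+x. ennreal_powr v \<alpha> * ((\<integral>\<^sup>+y\<in>R. h x y \<partial>lborel) * indicator R x) \<partial>lborel)"
      by (subst nn_integral_cmult) (auto simp: mult_ac)
    also have "\<dots> \<le> C * (\<integral>\<^sup>+x\<in>R. g x \<partial>lborel)"
    proof (intro mult_left_mono nn_integral_mono)
      fix x
      show "ennreal_powr v \<alpha> * ((\<integral>\<^sup>+y\<in>R. h x y \<partial>lborel) * indicator R x) \<le> g x * indicator R x"
      proof (cases "x \<in> R")
        case True
        have "(\<integral>\<^sup>+y\<in>R. h x y \<partial>lborel) \<le> (\<integral>\<^sup>+y\<in>?Q. h x y \<partial>lborel)"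
          using RQ by (intro nn_integral_mono mult_left_mono) (auto simp: indicator_def)
        then show ?thesis
          using True ennreal_powr_mono[OF v[OF True] \<alpha>(1)] by (auto simp: g_def mult.commute intro!: mult_mono)
      qed simp
    qed simp
    finally show ?thesis .
  qed
  have "AE x in lborel. x \<in> E \<inter> ?Q \<longrightarrow> x \<in> \<Union>D"
    using AE_critical_cell[OF E small]
  proof eventually_elim
    case (elim x)
    show ?case
    proof
      assume x: "x \<in> E \<inter> ?Q"
      then obtain k where k: "emeasure lborel (cell k x) \<le> 2 ^ (?n + 1) * emeasure lborel (E \<inter> cell k x)"
          "2 * emeasure lborel (E \<inter> cell k x) \<le> emeasure lborel (cell k x)" using elim by blast
      have "cell k x \<subseteq> cell 0 x" by (rule cell_antimono) simp
      also have "cell 0 x = ?Q" using x by (simp add: cell_eq_iff)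
      finally have "cell k x \<in> F" using k by (auto simp: F_def)
      then show "x \<in> \<Union>D" unfolding D(4) using mem_cell by blast
    qed
  qed
  then have "(\<integral>\<^sup>+x\<in>E \<inter> ?Q. w x \<partial>lborel) \<le> (\<integral>\<^sup>+x\<in>\<Union>D. w x \<partial>lborel)"
    by (intro nn_integral_mono_AE) (auto elim!: eventually_mono simp: indicator_def)
  also have "\<dots> = emeasure (density lborel w) (\<Union>D)" by (simp add: emeasure_density)
  also have "\<dots> = (\<integral>\<^sup>+R. emeasure (density lborel w) R \<partial>count_space D)"
    using D Ds by (intro emeasure_countable_disjoint_Union) auto
  also have "\<dots> = (\<integral>\<^sup>+R. (\<integral>\<^sup>+x\<in>R. w x \<partial>lborel) \<partial>count_space D)"
    using Ds by (intro nn_integral_cong) (auto simp: emeasure_density)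
  finally have le: "(\<integral>\<^sup>+x\<in>E \<inter> ?Q. w x \<partial>lborel) \<le> (\<integral>\<^sup>+R. (\<integral>\<^sup>+x\<in>R. w x \<partial>lborel) \<partial>count_space D)" .
  have "(\<integral>\<^sup>+R. (\<integral>\<^sup>+x\<in>R. w x \<partial>lborel) \<partial>count_space D) = (\<integral>\<^sup>+R. emeasure (density lborel w) R \<partial>count_space D)"
    using Ds by (intro nn_integral_cong) (auto simp: emeasure_density)
  also have "\<dots> = emeasure (density lborel w) (\<Union>D)"
    using D Ds by (intro emeasure_countable_disjoint_Union[symmetric]) auto
  also have "\<dots> \<le> emeasure (density lborel w) ?Q" using UQ by (intro emeasure_mono) auto
  also have "\<dots> < \<infinity>" using fin by (simp add: emeasure_density)
  finally have fin': "(\<integral>\<^sup>+R. (\<integral>\<^sup>+x\<in>R. w x \<partial>lborel) \<partial>count_space D) < \<infinity>" .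
  have "ennreal_powr (\<integral>\<^sup>+x\<in>E \<inter> ?Q. w x \<partial>lborel) \<alpha> \<le> ennreal_powr (\<integral>\<^sup>+R. (\<integral>\<^sup>+x\<in>R. w x \<partial>lborel) \<partial>count_space D) \<alpha>"
    by (intro ennreal_powr_mono le \<alpha>)
  also have "\<dots> \<le> (\<integral>\<^sup>+R. ennreal_powr (\<integral>\<^sup>+x\<in>R. w x \<partial>lborel) \<alpha> \<partial>count_space D)"
    by (intro ennreal_powr_subadditive \<alpha> fin')
  also have "\<dots> \<le> (\<integral>\<^sup>+R. C * emeasure (density lborel g) R \<partial>count_space D)"
    using Ds cell_bound by (intro nn_integral_mono) (auto simp: emeasure_density)
  also have "\<dots> = C * (\<integral>\<^sup>+R. emeasure (density lborel g) R \<partial>count_space D)"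
    by (rule nn_integral_cmult) auto
  also have "(\<integral>\<^sup>+R. emeasure (density lborel g) R \<partial>count_space D) = emeasure (density lborel g) (\<Union>D)"
    using D Ds by (intro emeasure_countable_disjoint_Union[symmetric]) auto
  also have "C * \<dots> \<le> C * emeasure (density lborel g) ?Q" using UQ by (intro mult_left_mono emeasure_mono) auto
  also have "\<dots> = C * (\<integral>\<^sup>+x\<in>?Q. g x \<partial>lborel)" by (simp add: emeasure_density)
  finally show ?thesis by (simp add: C_def g_def h_def \<alpha>_def)
qed

text \<open>Either \<open>E\<close> or its complement fills at most half of the cube in the sense of Lebesgue measure, and the
  right-hand side does not distinguish between the two.\<close>
lemma weighted_isoperimetric:
  fixes \<delta> :: real and w :: "'a \<Rightarrow> ennreal"
  assumes E[measurable]: "E \<in> sets borel" and w[measurable]: "w \<in> borel_measurable borel"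
    and \<delta>: "0 \<le> \<delta>" "\<delta> < 1"
    and fin: "(\<integral>\<^sup>+x\<in>cell 0 a. w x \<partial>lborel) < \<infinity>"
  shows "ennreal_powr (min (\<integral>\<^sup>+x\<in>cell 0 a \<inter> E. w x \<partial>lborel) (\<integral>\<^sup>+x\<in>cell 0 a - E. w x \<partial>lborel)) ((DIM('a) - \<delta>) / DIM('a)) \<le>
    ennreal (2 ^ (DIM('a) + 3) * real DIM('a) ^ (DIM('a) + 1) * (1 - \<delta>)) *
    (\<integral>\<^sup>+x\<in>cell 0 a. (\<integral>\<^sup>+y\<in>cell 0 a. ennreal \<bar>indicator E x - indicator E y\<bar> * frac_kernel \<delta> x y \<partial>lborel)
        * ennreal_powr (dyadic_maximal w x) ((DIM('a) - \<delta>) / DIM('a)) \<partial>lborel)" (is "ennreal_powr (min ?a ?b) ?\<alpha> \<le> ?rhs E")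
proof -
  let ?Q = "cell 0 a"
  have "1 \<le> DIM('a)" using DIM_positive[where 'a='a] by linarith
  then have "1 \<le> real DIM('a)" by (simp only: real_of_nat_ge_one_iff)
  then have \<alpha>: "0 < ?\<alpha>" using \<delta> by (intro divide_pos_pos) linarith+
  have "emeasure lborel ?Q = emeasure lborel (E \<inter> ?Q) + emeasure lborel (- E \<inter> ?Q)"
    by (subst plus_emeasure) (auto intro!: arg_cong[where f="emeasure lborel"])
  then have "2 * emeasure lborel (E \<inter> ?Q) \<le> emeasure lborel ?Q \<or> 2 * emeasure lborel (- E \<inter> ?Q) \<le> emeasure lborel ?Q"
    unfolding mult_2 by (metis add_left_mono add_right_mono linear)
  then show ?thesis
  proof
    assume small: "2 * emeasure lborel (E \<inter> ?Q) \<le> emeasure lborel ?Q"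
    have "ennreal_powr (min ?a ?b) ?\<alpha> \<le> ennreal_powr ?a ?\<alpha>" using \<alpha> by (intro ennreal_powr_mono) auto
    also have "\<dots> \<le> ?rhs E" using weighted_isoperimetric_small[OF E w \<delta> small fin] by (simp only: Int_commute)
    finally show ?thesis .
  next
    assume small: "2 * emeasure lborel (- E \<inter> ?Q) \<le> emeasure lborel ?Q"
    have E': "- E \<in> sets borel" by measurable
    have "ennreal_powr (min ?a ?b) ?\<alpha> \<le> ennreal_powr ?b ?\<alpha>" using \<alpha> by (intro ennreal_powr_mono) auto
    also have "\<dots> \<le> ?rhs (- E)" using weighted_isoperimetric_small[OF E' w \<delta> small fin]
      by (simp only: Int_commute Diff_eq)
    also have "\<dots> = ?rhs E"
    proof -
      have "\<bar>indicator (- E) x - indicator (- E) y\<bar> = \<bar>indicator E x - indicator E y :: real\<bar>" for x y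
        by (auto simp: indicator_def)
      then show ?thesis by simp
    qed
    finally show ?thesis .
  qed
qed

end

section \<open>From level sets to powers of the oscillation\<close>

text \<open>The exponent \<open>p - 1\<close> is handled by Young's inequality
  \<open>g powr (p - 1) \<le> (1 - 1/p) * g powr p / s + s powr (p - 1) / p\<close>, integrated over \<open>S\<close>.\<close>
lemma Hoelder_on_set:
  fixes G :: "'b \<Rightarrow> real"
  assumes [measurable]: "S \<in> sets M" "G \<in> borel_measurable M" and G: "\<And>x. 0 \<le> G x" and p: "1 < p"
    and finS: "emeasure M S < \<infinity>" and finG: "(\<integral>\<^sup>+x. ennreal (G x powr p) \<partial>M) < \<infinity>"
  shows "(\<integral>\<^sup>+x\<in>S. ennreal (G x powr (p - 1)) \<partial>M) \<le>
     ennreal_powr (emeasure M S) (1 / p) * ennreal_powr (\<integral>\<^sup>+x. ennreal (G x powr p) \<partial>M) (1 - 1 / p)"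
proof -
  obtain m where m: "emeasure M S = ennreal m" "0 \<le> m" using finS by (cases "emeasure M S") auto
  obtain b where b: "(\<integral>\<^sup>+x. ennreal (G x powr p) \<partial>M) = ennreal b" "0 \<le> b"
    using finG by (cases "\<integral>\<^sup>+x. ennreal (G x powr p) \<partial>M") auto
  consider "m = 0" | "b = 0" | "0 < m" "0 < b" using m b by fastforce
  then show ?thesis
  proof cases
    case 1
    then have "S \<in> null_sets M" using m by (auto simp: null_sets_def)
    then have "(\<integral>\<^sup>+x\<in>S. ennreal (G x powr (p - 1)) \<partial>M) = 0" by (rule nn_integral_null_set)
    then show ?thesis by simp
  next
    case 2
    then have "AE x in M. ennreal (G x powr p) = 0"
      using b by (subst nn_integral_0_iff_AE[symmetric]) auto
    then have "AE x in M. ennreal (G x powr (p - 1)) * indicator S x = 0"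
      by eventually_elim (auto simp: ennreal_eq_0_iff)
    then have "(\<integral>\<^sup>+x\<in>S. ennreal (G x powr (p - 1)) \<partial>M) = 0"
      by (subst nn_integral_0_iff_AE) auto
    then show ?thesis by simp
  next
    case 3
    \<comment> \<open>This choice makes \<open>b / s\<close> and \<open>s powr (p - 1) * m\<close> equal, so that the weights \<open>1 - 1/p\<close> and \<open>1/p\<close> add up.\<close>
    define s where "s = (b / m) powr (1 / p)"
    have s: "0 < s" using 3 by (simp add: s_def)
    have young: "G x powr (p - 1) \<le> (1 - 1 / p) / s * G x powr p + s powr (p - 1) / p" for x
    proof (cases "G x = 0")
      case False
      then have g: "0 < G x" using G[of x] by simp
      have "(G x powr p / s) powr (1 - 1 / p) * (s powr (p - 1)) powr (1 / p)
          \<le> (1 - 1 / p) * (G x powr p / s) + (1 / p) * s powr (p - 1)"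
        using p g s by (intro Youngs_inequality_0) auto
      also have "(G x powr p / s) powr (1 - 1 / p) * (s powr (p - 1)) powr (1 / p) = G x powr (p - 1)"
      proof -
        have e: "p * (1 - 1 / p) = p - 1" "(p - 1) * (1 / p) = 1 - 1 / p" using p by (auto simp: field_simps)
        show ?thesis using s g by (simp only: powr_divide powr_powr e) simp
      qed
      finally show ?thesis by simp
    qed (use s p in auto)
    have "(\<integral>\<^sup>+x\<in>S. ennreal (G x powr (p - 1)) \<partial>M) \<le>
        (\<integral>\<^sup>+x. ennreal ((1 - 1 / p) / s) * ennreal (G x powr p) + ennreal (s powr (p - 1) / p) * indicator S x \<partial>M)"
    proof (rule nn_integral_mono)
      fix x
      show "ennreal (G x powr (p - 1)) * indicator S x \<le>
        ennreal ((1 - 1 / p) / s) * ennreal (G x powr p) + ennreal (s powr (p - 1) / p) * indicator S x"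
        using young[of x] p s
        by (auto simp: indicator_def ennreal_mult'[symmetric] ennreal_plus[symmetric] intro!: ennreal_leI simp del: ennreal_plus)
    qed
    also have "\<dots> = ennreal ((1 - 1 / p) / s) * ennreal b + ennreal (s powr (p - 1) / p) * ennreal m"
      by (simp add: nn_integral_add nn_integral_cmult nn_integral_cmult_indicator b(1) m(1))
    also have "\<dots> = ennreal ((1 - 1 / p) * (b / s) + (s powr (p - 1) * m) / p)"
      using p s b m by (simp add: ennreal_mult'[symmetric] ennreal_plus[symmetric] mult_ac del: ennreal_plus)
    also have "b / s = m powr (1 / p) * b powr (1 - 1 / p)"
    proof -
      have "b / s = b powr 1 / (b powr (1 / p) / m powr (1 / p))" using 3 by (simp add: s_def powr_divide)
      also have "\<dots> = m powr (1 / p) * (b powr 1 / b powr (1 / p))" by simp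
      also have "b powr 1 / b powr (1 / p) = b powr (1 - 1 / p)" by (rule powr_diff[symmetric])
      finally show ?thesis .
    qed
    also have "s powr (p - 1) * m = m powr (1 / p) * b powr (1 - 1 / p)"
    proof -
      have e: "1 / p * (p - 1) = 1 - 1 / p" using p by (auto simp: field_simps)
      have "s powr (p - 1) = b powr (1 - 1 / p) / m powr (1 - 1 / p)"
        unfolding s_def powr_powr e using 3 by (simp add: powr_divide)
      then have "s powr (p - 1) * m = b powr (1 - 1 / p) * (m powr 1 / m powr (1 - 1 / p))" using 3 by simp
      also have "m powr 1 / m powr (1 - 1 / p) = m powr (1 / p)" by (subst powr_diff[symmetric]) simp
      finally show ?thesis by (simp add: mult.commute)
    qed
    also have "(1 - 1 / p) * (m powr (1 / p) * b powr (1 - 1 / p)) + m powr (1 / p) * b powr (1 - 1 / p) / p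
       = m powr (1 / p) * b powr (1 - 1 / p)"
      using p by (simp add: field_simps)
    also have "ennreal \<dots> = ennreal_powr (emeasure M S) (1 / p) * ennreal_powr (\<integral>\<^sup>+x. ennreal (G x powr p) \<partial>M) (1 - 1 / p)"
      using m b by (simp add: ennreal_powr_ennreal ennreal_mult')
    finally show ?thesis .
  qed
qed

text \<open>The thresholds \<open>t\<close> separating \<open>a\<close> from \<open>b\<close> form an interval of length \<open>\<bar>a - b\<bar>\<close>.\<close>
lemma ennreal_abs_diff_eq_level_integral:
  "ennreal \<bar>a - b\<bar> = (\<integral>\<^sup>+t. (if t < a then (if t < b then 0 else 1) else (if t < b then 1 else 0)) \<partial>lborel)"
proof -
  have "(\<integral>\<^sup>+t. (if t < a then (if t < b then 0 else 1) else (if t < b then 1 else 0)) \<partial>lborel) =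
     (\<integral>\<^sup>+t. indicator {min a b..<max a b} t \<partial>lborel)"
    by (intro nn_integral_cong) (auto simp: indicator_def min_def max_def)
  also have "\<dots> = ennreal \<bar>a - b\<bar>"
    by (subst nn_integral_indicator) (auto simp: min_def max_def)
  finally show ?thesis by simp
qed

text \<open>If \<open>a \<le> b\<close>, then \<open>a * b powr (1/p) \<le> b * a powr (1/p)\<close>, so each summand is at most
  \<open>(a + b) * a powr (1/p)\<close>.\<close>
lemma swapped_powr_sum_le:
  fixes a b :: ennreal
  assumes p: "1 < p" and fin: "a < \<infinity>" "b < \<infinity>"
  shows "b * ennreal_powr a (1 / p) + a * ennreal_powr b (1 / p) \<le> 2 * (a + b) * ennreal_powr (min a b) (1 / p)"
proof -
  have ord: "b * ennreal_powr a (1 / p) + a * ennreal_powr b (1 / p) \<le> 2 * (a + b) * ennreal_powr a (1 / p)"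
    if ab: "a \<le> b" "b < \<infinity>" for a b :: ennreal
  proof -
    obtain x y where xy: "a = ennreal x" "b = ennreal y" "0 \<le> x" "x \<le> y"
      using ab by (cases a; cases b) (auto simp: top_unique)
    have "x * y powr (1 / p) \<le> y * x powr (1 / p)"
    proof (cases "x = 0")
      case False
      have "x * y powr (1 / p) = x powr (1 / p) * (x powr (1 - 1 / p) * y powr (1 / p))"
        using False xy by (simp add: powr_diff)
      also have "\<dots> \<le> x powr (1 / p) * (y powr (1 - 1 / p) * y powr (1 / p))"
        using xy p by (intro mult_left_mono mult_right_mono powr_mono2) auto
      also have "\<dots> = y * x powr (1 / p)" using False xy by (simp add: powr_diff)
      finally show ?thesis .
    qed (use xy in auto)
    then have "a * ennreal_powr b (1 / p) \<le> b * ennreal_powr a (1 / p)"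
      using xy by (simp add: ennreal_powr_ennreal ennreal_mult'[symmetric] ennreal_leI)
    moreover have "b * ennreal_powr a (1 / p) \<le> (a + b) * ennreal_powr a (1 / p)"
      by (intro mult_right_mono) auto
    ultimately have "b * ennreal_powr a (1 / p) + a * ennreal_powr b (1 / p) \<le>
       (a + b) * ennreal_powr a (1 / p) + (a + b) * ennreal_powr a (1 / p)"
      by (intro add_mono) auto
    then show ?thesis by (simp add: mult_2 distrib_right)
  qed
  show ?thesis
  proof (cases "a \<le> b")
    case True
    then show ?thesis using ord[of a b] fin by (simp add: min_def)
  next
    case False
    then show ?thesis using ord[of b a] fin by (simp add: min_def add.commute)
  qed
qed

text \<open>The hypothesis on \<open>G\<close> says that \<open>G\<close> is at most the mean of \<open>\<bar>u x - u y\<bar>\<close> over \<open>y\<close>, a superposition over \<open>t\<close> of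
  functions taking one value on \<open>{u > t}\<close> and another one on its complement.  Minkowski's inequality
  is proved by duality: write \<open>G\<^sup>p = G * G\<^sup>p\<^sup>-\<^sup>1\<close>, insert the superposition for the first factor, apply
  Hoelder's inequality for each \<open>t\<close>, and divide by the power \<open>1 - 1/p\<close> of the integral of \<open>G\<^sup>p\<close>.  The
  bound on \<open>G\<close> makes that integral finite, so that the division is legitimate.\<close>
proposition level_set_Minkowski:
  fixes u G :: "'b \<Rightarrow> real"
  assumes fm: "finite_measure M" and u[measurable]: "u \<in> borel_measurable M" and G[measurable]: "G \<in> borel_measurable M"
    and p: "1 < p" and GK: "\<And>x. 0 \<le> G x" "\<And>x. G x \<le> K"
    and pos: "0 < emeasure M (space M)"
    and le: "AE x in M. ennreal (G x) * emeasure M (space M) \<le> (\<integral>\<^sup>+y. ennreal \<bar>u x - u y\<bar> \<partial>M)"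
  shows "ennreal_powr (\<integral>\<^sup>+x. ennreal (G x powr p) \<partial>M) (1 / p) \<le>
    2 * (\<integral>\<^sup>+t. ennreal_powr (min (emeasure M {x\<in>space M. t < u x}) (emeasure M {x\<in>space M. \<not> t < u x})) (1 / p) \<partial>lborel)"
proof -
  interpret M: finite_measure M by (rule fm)
  interpret P: pair_sigma_finite M lborel ..
  define T where "T = emeasure M (space M)"
  define a where "a t = (\<integral>\<^sup>+y. (if t < u y then 1 else 0) \<partial>M)" for t
  define b where "b t = (\<integral>\<^sup>+y. (if t < u y then 0 else 1) \<partial>M)" for t
  have a[measurable]: "a \<in> borel_measurable borel" unfolding a_def by measurable
  have b[measurable]: "b \<in> borel_measurable borel" unfolding b_def by measurable
  have a_eq: "a t = emeasure M {x\<in>space M. t < u x}" for t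
  proof -
    have "a t = (\<integral>\<^sup>+x. indicator {x\<in>space M. t < u x} x \<partial>M)"
      unfolding a_def by (intro nn_integral_cong) (auto simp: indicator_def)
    then show ?thesis by simp
  qed
  have b_eq: "b t = emeasure M {x\<in>space M. \<not> t < u x}" for t
  proof -
    have "b t = (\<integral>\<^sup>+x. indicator {x\<in>space M. \<not> t < u x} x \<partial>M)"
      unfolding b_def by (intro nn_integral_cong) (auto simp: indicator_def)
    then show ?thesis by simp
  qed
  have ab: "a t + b t = T" for t
    unfolding a_eq b_eq T_def by (subst plus_emeasure) (auto intro!: arg_cong[where f="emeasure M"])
  have T: "T < \<infinity>" "0 < T" using pos by (auto simp: T_def simp flip: less_top)
  have fin: "a t < \<infinity>" "b t < \<infinity>" for t
    unfolding a_eq b_eq by (auto simp flip: less_top)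
  define B where "B = (\<integral>\<^sup>+x. ennreal (G x powr p) \<partial>M)"
  define Y where "Y = (\<integral>\<^sup>+t. ennreal_powr (min (a t) (b t)) (1 / p) \<partial>lborel)"
  have "B \<le> (\<integral>\<^sup>+x. ennreal (K powr p) \<partial>M)"
    unfolding B_def using GK p by (intro nn_integral_mono ennreal_leI powr_mono2) auto
  also have "\<dots> < \<infinity>" using T by (simp add: T_def ennreal_mult_less_top)
  finally have Bfin: "B < \<infinity>" .
  have osc: "(\<integral>\<^sup>+y. ennreal \<bar>u x - u y\<bar> \<partial>M) = (\<integral>\<^sup>+t. (if t < u x then b t else a t) \<partial>lborel)" for x
  proof -
    have "(\<integral>\<^sup>+y. ennreal \<bar>u x - u y\<bar> \<partial>M) =
      (\<integral>\<^sup>+y. (\<integral>\<^sup>+t. (if t < u x then (if t < u y then 0 else 1) else (if t < u y then 1 else 0)) \<partial>lborel) \<partial>M)"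
      by (simp only: ennreal_abs_diff_eq_level_integral)
    also have "\<dots> = (\<integral>\<^sup>+t. (\<integral>\<^sup>+y. (if t < u x then (if t < u y then 0 else 1) else (if t < u y then 1 else 0)) \<partial>M) \<partial>lborel)"
      by (rule P.Fubini'[symmetric]) measurable
    also have "\<dots> = (\<integral>\<^sup>+t. (if t < u x then b t else a t) \<partial>lborel)"
      by (intro nn_integral_cong) (auto simp: a_def b_def)
    finally show ?thesis .
  qed
  have "T * B = (\<integral>\<^sup>+x. (ennreal (G x) * T) * ennreal (G x powr (p - 1)) \<partial>M)"
  proof -
    have "T * ennreal (G x powr p) = (ennreal (G x) * T) * ennreal (G x powr (p - 1))" for x
    proof -
      have "G x powr p = G x * G x powr (p - 1)" using GK(1)[of x] by (cases "G x = 0") (auto simp: powr_diff)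
      then show ?thesis using GK(1)[of x] by (simp add: ennreal_mult' mult_ac)
    qed
    then show ?thesis unfolding B_def by (subst nn_integral_cmult[symmetric]) auto
  qed
  also have "\<dots> \<le> (\<integral>\<^sup>+x. (\<integral>\<^sup>+t. (if t < u x then b t else a t) \<partial>lborel) * ennreal (G x powr (p - 1)) \<partial>M)"
  proof (rule nn_integral_mono_AE)
    show "AE x in M. (ennreal (G x) * T) * ennreal (G x powr (p - 1)) \<le>
       (\<integral>\<^sup>+t. (if t < u x then b t else a t) \<partial>lborel) * ennreal (G x powr (p - 1))"
      using le unfolding osc T_def[symmetric] by eventually_elim (intro mult_right_mono, auto)
  qed
  also have "\<dots> = (\<integral>\<^sup>+x. (\<integral>\<^sup>+t. (if t < u x then b t else a t) * ennreal (G x powr (p - 1)) \<partial>lborel) \<partial>M)"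
    by (subst nn_integral_multc) auto
  also have "\<dots> = (\<integral>\<^sup>+t. (\<integral>\<^sup>+x. (if t < u x then b t else a t) * ennreal (G x powr (p - 1)) \<partial>M) \<partial>lborel)"
    by (rule P.Fubini'[symmetric]) measurable
  also have "\<dots> \<le> (\<integral>\<^sup>+t. (2 * T * ennreal_powr B (1 - 1 / p)) * ennreal_powr (min (a t) (b t)) (1 / p) \<partial>lborel)"
  proof (rule nn_integral_mono)
    fix t :: real
    let ?A = "{x\<in>space M. t < u x}" and ?A' = "{x\<in>space M. \<not> t < u x}"
    have "(\<integral>\<^sup>+x. (if t < u x then b t else a t) * ennreal (G x powr (p - 1)) \<partial>M)
       = (\<integral>\<^sup>+x. b t * (ennreal (G x powr (p - 1)) * indicator ?A x) + a t * (ennreal (G x powr (p - 1)) * indicator ?A' x) \<partial>M)"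
      by (intro nn_integral_cong) (auto simp: indicator_def)
    also have "\<dots> = b t * (\<integral>\<^sup>+x\<in>?A. ennreal (G x powr (p - 1)) \<partial>M) + a t * (\<integral>\<^sup>+x\<in>?A'. ennreal (G x powr (p - 1)) \<partial>M)"
      by (subst nn_integral_add, measurable) (simp add: nn_integral_cmult)
    also have "\<dots> \<le> b t * (ennreal_powr (a t) (1 / p) * ennreal_powr B (1 - 1 / p)) + a t * (ennreal_powr (b t) (1 / p) * ennreal_powr B (1 - 1 / p))"
      unfolding B_def a_eq b_eq
      by (intro add_mono mult_left_mono Hoelder_on_set)
         (use GK p fin[of t] Bfin in \<open>auto simp: B_def a_eq b_eq\<close>)
    also have "\<dots> = (b t * ennreal_powr (a t) (1 / p) + a t * ennreal_powr (b t) (1 / p)) * ennreal_powr B (1 - 1 / p)"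
      by (simp add: distrib_right mult.assoc)
    also have "\<dots> \<le> (2 * (a t + b t) * ennreal_powr (min (a t) (b t)) (1 / p)) * ennreal_powr B (1 - 1 / p)"
      by (intro mult_right_mono swapped_powr_sum_le p fin) auto
    also have "\<dots> = (2 * T * ennreal_powr B (1 - 1 / p)) * ennreal_powr (min (a t) (b t)) (1 / p)"
      unfolding ab by (simp only: mult_ac)
    finally show "(\<integral>\<^sup>+x. (if t < u x then b t else a t) * ennreal (G x powr (p - 1)) \<partial>M) \<le>
      (2 * T * ennreal_powr B (1 - 1 / p)) * ennreal_powr (min (a t) (b t)) (1 / p)" .
  qed
  also have "\<dots> = (2 * T * ennreal_powr B (1 - 1 / p)) * Y"
    unfolding Y_def by (rule nn_integral_cmult) measurable
  also have "\<dots> = T * (2 * Y * ennreal_powr B (1 - 1 / p))" by (simp only: mult_ac)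
  finally have "T * B \<le> T * (2 * Y * ennreal_powr B (1 - 1 / p))" .
  then have main: "B \<le> 2 * Y * ennreal_powr B (1 - 1 / p)"
    using T by (subst (asm) ennreal_mult_le_mult_iff) auto
  have "ennreal_powr B (1 / p) \<le> 2 * Y"
  proof (cases "B = 0")
    case False
    then obtain \<beta> where \<beta>: "B = ennreal \<beta>" "0 < \<beta>" using Bfin by (cases B) (auto simp: order_less_le)
    have "ennreal_powr B (1 / p) = ennreal (\<beta> powr (1 / p - 1)) * B"
      using \<beta> by (simp add: ennreal_powr_ennreal ennreal_mult'[symmetric] powr_diff)
    also have "\<dots> \<le> ennreal (\<beta> powr (1 / p - 1)) * (2 * Y * ennreal_powr B (1 - 1 / p))"
      by (intro mult_left_mono main) auto
    also have "\<dots> = (ennreal (\<beta> powr (1 / p - 1)) * ennreal (\<beta> powr (1 - 1 / p))) * (2 * Y)"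
      using \<beta> by (simp add: ennreal_powr_ennreal mult_ac)
    also have "ennreal (\<beta> powr (1 / p - 1)) * ennreal (\<beta> powr (1 - 1 / p)) = 1"
      using \<beta> by (simp add: ennreal_mult'[symmetric] powr_add[symmetric])
    finally show ?thesis by simp
  qed simp
  then show ?thesis by (simp only: B_def Y_def a_eq b_eq)
qed

section \<open>The weighted Poincare-Sobolev inequality on a dyadic cube\<close>

lemma mean_deviation_le:
  fixes u :: "'b \<Rightarrow> real"
  assumes fm: "finite_measure M" and u: "integrable M u" and pos: "0 < measure M (space M)"
  shows "ennreal \<bar>c - (\<integral>y. u y \<partial>M) / measure M (space M)\<bar> * emeasure M (space M) \<le> (\<integral>\<^sup>+y. ennreal \<bar>c - u y\<bar> \<partial>M)"
proof -
  interpret finite_measure M by (rule fm)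
  let ?m = "measure M (space M)"
  have "\<bar>c - (\<integral>y. u y \<partial>M) / ?m\<bar> * ?m = \<bar>c * ?m - (\<integral>y. u y \<partial>M)\<bar>"
  proof -
    have "\<bar>c - (\<integral>y. u y \<partial>M) / ?m\<bar> * ?m = \<bar>(c - (\<integral>y. u y \<partial>M) / ?m) * ?m\<bar>" using pos by (simp add: abs_mult)
    also have "(c - (\<integral>y. u y \<partial>M) / ?m) * ?m = c * ?m - (\<integral>y. u y \<partial>M)" using pos by (simp add: left_diff_distrib)
    finally show ?thesis .
  qed
  also have "c * ?m - (\<integral>y. u y \<partial>M) = (\<integral>y. c - u y \<partial>M)"
    using u by (subst Bochner_Integration.integral_diff) auto
  also have "\<bar>\<integral>y. c - u y \<partial>M\<bar> \<le> (\<integral>y. \<bar>c - u y\<bar> \<partial>M)"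
    using u by (intro integral_abs_bound)
  finally have "ennreal (\<bar>c - (\<integral>y. u y \<partial>M) / ?m\<bar> * ?m) \<le> ennreal (\<integral>y. \<bar>c - u y\<bar> \<partial>M)"
    by (rule ennreal_leI)
  also have "\<dots> = (\<integral>\<^sup>+y. ennreal \<bar>c - u y\<bar> \<partial>M)"
    using u by (intro nn_integral_eq_integral[symmetric]) auto
  finally show ?thesis by (simp add: emeasure_eq_measure ennreal_mult')
qed

text \<open>Apply the isoperimetric inequality to every level set \<open>{u > t}\<close> and integrate over \<open>t\<close>.  By Tonelli's
  theorem the jumps of the indicators integrate to \<open>\<bar>u x - u y\<bar>\<close>.\<close>
lemma (in dyadic_grid) weighted_Poincare_Sobolev_cube:
  fixes w :: "'a \<Rightarrow> ennreal" and u G :: "'a \<Rightarrow> real" and \<delta> :: real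
  defines "\<nu> \<equiv> density lborel (\<lambda>x. w x * indicator (cell 0 a) x)"
  assumes w[measurable]: "w \<in> borel_measurable borel" and u[measurable]: "u \<in> borel_measurable borel"
    and G[measurable]: "G \<in> borel_measurable borel" and GK: "\<And>x. 0 \<le> G x" "\<And>x. G x \<le> K"
    and \<delta>: "0 < \<delta>" "\<delta> < 1"
    and fin: "emeasure \<nu> UNIV < \<infinity>" and pos: "0 < emeasure \<nu> UNIV"
    and le: "\<And>x. ennreal (G x) * emeasure \<nu> UNIV \<le> (\<integral>\<^sup>+y. ennreal \<bar>u x - u y\<bar> \<partial>\<nu>)"
  shows "ennreal_powr (\<integral>\<^sup>+x\<in>cell 0 a. ennreal (G x powr (DIM('a) / (DIM('a) - \<delta>))) * w x \<partial>lborel) ((DIM('a) - \<delta>) / DIM('a)) \<le>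
     ennreal (2 ^ (DIM('a) + 4) * real DIM('a) ^ (DIM('a) + 1) * (1 - \<delta>)) *
     (\<integral>\<^sup>+x\<in>cell 0 a. (\<integral>\<^sup>+y\<in>cell 0 a. ennreal \<bar>u x - u y\<bar> * frac_kernel \<delta> x y \<partial>lborel)
        * ennreal_powr (dyadic_maximal w x) ((DIM('a) - \<delta>) / DIM('a)) \<partial>lborel)"
proof -
  let ?n = "DIM('a)" and ?Q = "cell 0 a"
  define \<alpha> where "\<alpha> = (?n - \<delta>) / ?n"
  define C where "C = ennreal (2 ^ (?n + 3) * real ?n ^ (?n + 1) * (1 - \<delta>))"
  define p where "p = ?n / (?n - \<delta>)"
  have "1 \<le> ?n" using DIM_positive[where 'a='a] by linarith
  then have n1: "1 \<le> real ?n" by (simp only: real_of_nat_ge_one_iff)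
  have p: "1 < p" unfolding p_def using n1 \<delta> by (subst less_divide_eq_1_pos) linarith+
  have p\<alpha>: "1 / p = \<alpha>" by (simp add: p_def \<alpha>_def)
  have [measurable_cong]: "sets \<nu> = sets borel" by (simp add: \<nu>_def)
  have sp: "space \<nu> = UNIV" by (simp add: \<nu>_def)
  have fm: "finite_measure \<nu>" using fin by (intro finite_measureI) (simp add: sp)
  have eQ: "emeasure \<nu> E = (\<integral>\<^sup>+x\<in>?Q \<inter> E. w x \<partial>lborel)" if "E \<in> sets borel" for E
    unfolding \<nu>_def using that
    by (subst emeasure_density) (auto intro!: nn_integral_cong simp: indicator_def)
  have finQ: "(\<integral>\<^sup>+x\<in>?Q. w x \<partial>lborel) < \<infinity>" using fin eQ[of UNIV] by simp
  define h where "h t x y = ennreal \<bar>indicator {x. t < u x} x - indicator {x. t < u x} y\<bar> * frac_kernel \<delta> x y" for t x y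
  define V where "V x = ennreal_powr (dyadic_maximal w x) \<alpha>" for x
  have V[measurable]: "V \<in> borel_measurable borel" unfolding V_def by measurable
  have h_eq: "h t x y = (if t < u x then (if t < u y then 0 else 1) else (if t < u y then 1 else 0)) * frac_kernel \<delta> x y" for t x y
    by (simp add: h_def)
  have [measurable]: "(\<lambda>t. \<integral>\<^sup>+y\<in>?Q. h t x y \<partial>lborel) \<in> borel_measurable borel" for x
    unfolding h_eq by measurable
  have [measurable]: "(\<lambda>t. \<integral>\<^sup>+x\<in>?Q. (\<integral>\<^sup>+y\<in>?Q. h t x y \<partial>lborel) * V x \<partial>lborel) \<in> borel_measurable borel"
    unfolding h_eq by measurable
  have iso: "ennreal_powr (min (emeasure \<nu> {x\<in>space \<nu>. t < u x}) (emeasure \<nu> {x\<in>space \<nu>. \<not> t < u x})) (1 / p)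
      \<le> C * (\<integral>\<^sup>+x\<in>?Q. (\<integral>\<^sup>+y\<in>?Q. h t x y \<partial>lborel) * V x \<partial>lborel)" for t
  proof -
    have E: "{x. t < u x} \<in> sets borel" "{x. \<not> t < u x} \<in> sets borel" by measurable
    have "?Q - {x. t < u x} = ?Q \<inter> {x. \<not> t < u x}" by auto
    then have e: "emeasure \<nu> {x. t < u x} = (\<integral>\<^sup>+x\<in>?Q \<inter> {x. t < u x}. w x \<partial>lborel)"
      "emeasure \<nu> {x. \<not> t < u x} = (\<integral>\<^sup>+x\<in>?Q - {x. t < u x}. w x \<partial>lborel)"
      using eQ[OF E(1)] eQ[OF E(2)] by simp_all
    show ?thesis
      unfolding sp using weighted_isoperimetric[OF E(1) w less_imp_le[OF \<delta>(1)] \<delta>(2) finQ]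
      by (simp only: UNIV_I simp_thms e p\<alpha> C_def V_def h_def \<alpha>_def)
  qed
  have swap: "(\<integral>\<^sup>+t. (\<integral>\<^sup>+x\<in>?Q. (\<integral>\<^sup>+y\<in>?Q. h t x y \<partial>lborel) * V x \<partial>lborel) \<partial>lborel)
     = (\<integral>\<^sup>+x\<in>?Q. (\<integral>\<^sup>+y\<in>?Q. ennreal \<bar>u x - u y\<bar> * frac_kernel \<delta> x y \<partial>lborel) * V x \<partial>lborel)"
  proof -
    have "(\<integral>\<^sup>+t. (\<integral>\<^sup>+x\<in>?Q. (\<integral>\<^sup>+y\<in>?Q. h t x y \<partial>lborel) * V x \<partial>lborel) \<partial>lborel)
      = (\<integral>\<^sup>+x. (\<integral>\<^sup>+t. (\<integral>\<^sup>+y\<in>?Q. h t x y \<partial>lborel) * V x * indicator ?Q x \<partial>lborel) \<partial>lborel)"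
      by (rule lborel_pair.Fubini', unfold h_eq, measurable)
    also have "\<dots> = (\<integral>\<^sup>+x\<in>?Q. (\<integral>\<^sup>+t. (\<integral>\<^sup>+y\<in>?Q. h t x y \<partial>lborel) \<partial>lborel) * V x \<partial>lborel)"
      by (simp add: nn_integral_multc)
    also have "\<dots> = (\<integral>\<^sup>+x\<in>?Q. (\<integral>\<^sup>+y\<in>?Q. ennreal \<bar>u x - u y\<bar> * frac_kernel \<delta> x y \<partial>lborel) * V x \<partial>lborel)"
    proof -
      have "(\<integral>\<^sup>+t. (\<integral>\<^sup>+y\<in>?Q. h t x y \<partial>lborel) \<partial>lborel) = (\<integral>\<^sup>+y\<in>?Q. ennreal \<bar>u x - u y\<bar> * frac_kernel \<delta> x y \<partial>lborel)" for x
      proof -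
        have "(\<integral>\<^sup>+t. (\<integral>\<^sup>+y\<in>?Q. h t x y \<partial>lborel) \<partial>lborel) = (\<integral>\<^sup>+y. (\<integral>\<^sup>+t. h t x y * indicator ?Q y \<partial>lborel) \<partial>lborel)"
          by (rule lborel_pair.Fubini', unfold h_eq, measurable)
        also have "\<dots> = (\<integral>\<^sup>+y\<in>?Q. ennreal \<bar>u x - u y\<bar> * frac_kernel \<delta> x y \<partial>lborel)"
          unfolding h_eq ennreal_abs_diff_eq_level_integral by (simp add: nn_integral_multc)
        finally show ?thesis .
      qed
      then show ?thesis by simp
    qed
    finally show ?thesis .
  qed
  have "ennreal_powr (\<integral>\<^sup>+x. ennreal (G x powr p) \<partial>\<nu>) (1 / p) \<le>
    2 * (\<integral>\<^sup>+t. ennreal_powr (min (emeasure \<nu> {x\<in>space \<nu>. t < u x}) (emeasure \<nu> {x\<in>space \<nu>. \<not> t < u x})) (1 / p) \<partial>lborel)"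
    using pos le GK by (intro level_set_Minkowski[where K=K] fm p) (auto simp: sp)
  also have "\<dots> \<le> 2 * (\<integral>\<^sup>+t. C * (\<integral>\<^sup>+x\<in>?Q. (\<integral>\<^sup>+y\<in>?Q. h t x y \<partial>lborel) * V x \<partial>lborel) \<partial>lborel)"
    by (intro mult_left_mono nn_integral_mono iso) auto
  also have "\<dots> = 2 * (C * (\<integral>\<^sup>+x\<in>?Q. (\<integral>\<^sup>+y\<in>?Q. ennreal \<bar>u x - u y\<bar> * frac_kernel \<delta> x y \<partial>lborel) * V x \<partial>lborel))"
    unfolding swap[symmetric] by (subst nn_integral_cmult) measurable
  also have "\<dots> = ennreal (2 ^ (?n + 4) * real ?n ^ (?n + 1) * (1 - \<delta>)) *
      (\<integral>\<^sup>+x\<in>?Q. (\<integral>\<^sup>+y\<in>?Q. ennreal \<bar>u x - u y\<bar> * frac_kernel \<delta> x y \<partial>lborel) * V x \<partial>lborel)"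
  proof -
    have "2 * C = ennreal 2 * C" by simp
    also have "\<dots> = ennreal (2 ^ (?n + 4) * real ?n ^ (?n + 1) * (1 - \<delta>))"
      unfolding C_def by (subst ennreal_mult'[symmetric]) (auto simp: power_add mult_ac)
    finally show ?thesis by (simp only: mult.assoc[symmetric])
  qed
  also have "(\<integral>\<^sup>+x. ennreal (G x powr p) \<partial>\<nu>) = (\<integral>\<^sup>+x\<in>?Q. ennreal (G x powr p) * w x \<partial>lborel)"
    unfolding \<nu>_def by (subst nn_integral_density) (auto intro!: nn_integral_cong simp: mult_ac)
  finally show ?thesis by (simp only: p\<alpha> V_def) (simp only: \<alpha>_def p_def)
qed

section \<open>General cubes, and passage to the whole space\<close>

lemma mem_half_open_cube_cart:
  "x \<in> half_open_cube c r \<longleftrightarrow> (\<forall>i. c $ i \<le> x $ i \<and> x $ i < c $ i + r)"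
  by (auto simp: half_open_cube_def Basis_vec_def inner_axis)

lemma is_cube_half_open_cube:
  assumes "0 < r" shows "is_cube (half_open_cube c r)"
  unfolding is_cube_def
  by (rule exI[of _ "\<lambda>i. {c $ i..<c $ i + r}"], rule exI[of _ r])
     (use assms in \<open>auto simp: mem_half_open_cube_cart\<close>)

text \<open>An interval is squeezed between the open and the closed interval with its infimum and supremum as
  endpoints; it is bounded because it contains the segment between any two of its points and has finite
  length.\<close>
lemma interval_between:
  fixes I :: "real set"
  assumes I: "is_interval I" and l: "emeasure lborel I = ennreal l" "0 < l"
  shows "\<exists>c. {c<..<c + l} \<subseteq> I \<and> I \<subseteq> {c..c + l}"
proof -
  have sets: "I \<in> sets lborel"
  proof (rule ccontr)
    assume "I \<notin> sets lborel"
    then have "emeasure lborel I = 0" by (rule emeasure_notin_sets)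
    then show False using l by simp
  qed
  have sub: "{x..y} \<subseteq> I" if "x \<in> I" "y \<in> I" for x y
    using mem_is_interval_1_I[OF I that] by auto
  have len: "y - x \<le> l" if "x \<in> I" "y \<in> I" "x \<le> y" for x y
  proof -
    have "emeasure lborel {x..y} \<le> emeasure lborel I" using sub that sets by (intro emeasure_mono) auto
    then show ?thesis using that l by simp
  qed
  have "I \<noteq> {}" using l by auto
  then obtain z where z: "z \<in> I" by blast
  have bnd: "bdd_below I" "bdd_above I"
  proof -
    show "bdd_below I"
    proof (rule bdd_belowI[of _ "z - l"])
      fix x assume "x \<in> I" then show "z - l \<le> x" using len[of x z] z l by (cases "x \<le> z") auto
    qed
    show "bdd_above I"
    proof (rule bdd_aboveI[of _ "z + l"])
      fix x assume "x \<in> I" then show "x \<le> z + l" using len[of z x] z l by (cases "z \<le> x") auto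
    qed
  qed
  define c where "c = Inf I"
  define d where "d = Sup I"
  have up: "I \<subseteq> {c..d}" using bnd by (auto simp: c_def d_def intro: cInf_lower cSup_upper)
  have low: "{c<..<d} \<subseteq> I"
  proof
    fix x assume "x \<in> {c<..<d}"
    then have "Inf I < x" "x < Sup I" by (auto simp: c_def d_def)
    then obtain y y' where "y \<in> I" "y < x" "y' \<in> I" "x < y'"
      using cInf_lessD less_cSupD \<open>I \<noteq> {}\<close> by meson
    then show "x \<in> I" using sub[of y y'] by auto
  qed
  have cd: "c \<le> d" using up z by auto
  have "emeasure lborel I \<le> emeasure lborel {c..d}" using up by (intro emeasure_mono) auto
  moreover have "emeasure lborel {c<..<d} \<le> emeasure lborel I" using low sets by (intro emeasure_mono) auto
  ultimately have "d = c + l" using l cd by simp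
  then show ?thesis using up low by blast
qed

text \<open>A cube differs from a half-open one only on the boundary of a box.\<close>
lemma is_cube_AE_half_open_cube:
  fixes Q :: "(real ^ 'n) set"
  assumes "is_cube Q"
  obtains a l where "0 < l" "Q \<in> sets borel" "Q \<subseteq> cbox a (a + l *\<^sub>R One)" "AE x in lborel. x \<in> Q \<longleftrightarrow> x \<in> half_open_cube a l"
proof -
  obtain I l where *: "0 < l \<and> (\<forall>i. is_interval (I i) \<and> emeasure lborel (I i) = ennreal l) \<and> Q = {x. \<forall>i. x $ i \<in> I i}"
    using assms unfolding is_cube_def by blast
  then have l: "0 < l" and I: "\<And>i. is_interval (I i)" "\<And>i. emeasure lborel (I i) = ennreal l"
    and Q: "Q = {x. \<forall>i. x $ i \<in> I i}" by blast+
  have "\<forall>i. \<exists>c. {c<..<c + l} \<subseteq> I i \<and> I i \<subseteq> {c..c + l}"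
    using interval_between[OF I l] by blast
  then obtain c where "\<forall>i. {c i<..<c i + l} \<subseteq> I i \<and> I i \<subseteq> {c i..c i + l}"
    by (elim choice[THEN exE])
  then have c: "\<And>i. {c i<..<c i + l} \<subseteq> I i" "\<And>i. I i \<subseteq> {c i..c i + l}"
    by blast+
  define a :: "real ^ 'n" where "a = (\<chi> i. c i)"
  have One: "(One :: real ^ 'n) $ i = 1" for i
  proof -
    have "(axis i 1 :: real ^ 'n) \<in> Basis" by (simp add: axis_in_Basis_iff)
    then have "(One :: real ^ 'n) \<bullet> axis i 1 = 1" by simp
    then show ?thesis by (simp only: cart_eq_inner_axis)
  qed
  let ?b = "a + l *\<^sub>R One"
  have b: "?b $ i = c i + l" for i by (simp only: vector_add_component vector_scaleR_component One) (simp add: a_def)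
  have a: "a $ i = c i" for i by (simp add: a_def)
  have low: "box a ?b \<subseteq> Q"
  proof
    fix x assume "x \<in> box a ?b"
    then have "x $ i \<in> {c i<..<c i + l}" for i unfolding mem_box_cart b a by simp
    then show "x \<in> Q" unfolding Q using c(1) by blast
  qed
  have up: "Q \<subseteq> cbox a ?b"
  proof
    fix x assume "x \<in> Q"
    then have "x $ i \<in> {c i..c i + l}" for i unfolding Q using c(2)[of i] by blast
    then show "x \<in> cbox a ?b" unfolding mem_box_cart b a by simp
  qed
  have e: "emeasure lborel (cbox a ?b) = emeasure lborel (box a ?b)"
    using l by (subst emeasure_lborel_box, simp add: inner_add_left) (subst emeasure_lborel_cbox, auto simp: inner_add_left)
  have "emeasure lborel (cbox a ?b - box a ?b) = 0"
    using emeasure_lborel_box_finite[of a ?b]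
    by (subst emeasure_Diff) (auto simp: e box_subset_cbox)
  then have "cbox a ?b - box a ?b \<in> null_sets lborel" by (auto simp: null_sets_def)
  then have "AE x in lborel. x \<notin> cbox a ?b - box a ?b" by (rule AE_not_in)
  then have "AE x in lborel. x \<in> Q \<longleftrightarrow> x \<in> half_open_cube a l"
    by eventually_elim (use low up half_open_cube_bounds[of a l] in blast)
  moreover have "Q \<in> sets borel"
  proof -
    have "I i \<in> sets borel" for i using emeasure_notin_sets[of "I i" lborel] I(2)[of i] l by fastforce
    moreover have "(\<lambda>x :: real ^ 'n. x $ i) \<in> borel_measurable borel" for i
      by (intro borel_measurable_continuous_onI continuous_intros)
    ultimately have "(\<lambda>x :: real ^ 'n. x $ i) -` I i \<in> sets borel" for i by (intro measurable_sets_borel)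
    then have "(\<Inter>i. (\<lambda>x :: real ^ 'n. x $ i) -` I i) \<in> sets borel" by (intro sets.finite_INT) auto
    also have "(\<Inter>i. (\<lambda>x :: real ^ 'n. x $ i) -` I i) = Q" by (auto simp: Q)
    finally show ?thesis .
  qed
  ultimately show ?thesis using that l up by blast
qed

lemma locally_integrable_imp_measurable:
  assumes "locally_integrable M f" and M: "sets M = sets lebesgue"
  shows "f \<in> borel_measurable lebesgue"
proof (rule borel_measurable_LIMSEQ_real)
  fix j :: nat
  have "set_integrable M (cball 0 (real j)) f" using assms by (auto simp: locally_integrable_def)
  then have "(\<lambda>x. indicator (cball 0 (real j)) x *\<^sub>R f x) \<in> borel_measurable M"
    unfolding set_integrable_def by (rule borel_measurable_integrable)
  then show "(\<lambda>x. indicator (cball 0 (real j)) x *\<^sub>R f x) \<in> borel_measurable lebesgue"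
    using M measurable_cong_sets by blast
next
  fix x :: "real ^ 'a"
  obtain N :: nat where N: "norm x \<le> N" using real_arch_simple by blast
  show "(\<lambda>j. indicator (cball 0 (real j)) x *\<^sub>R f x) \<longlonglongrightarrow> f x"
    by (rule tendsto_eventually, rule eventually_sequentiallyI[of N]) (use N in auto)
qed

lemma AE_lebesgue_iff: "(AE x in lebesgue. P x) \<longleftrightarrow> (AE x in lborel. P x)"
  by (rule AE_completion_iff)

text \<open>Cells are cubes, so the dyadic supremum runs over fewer cubes.\<close>
lemma dyadic_maximal_le_maximal_function:
  fixes w :: "real ^ 'n \<Rightarrow> real"
  assumes G: "dyadic_grid l" and ae: "AE x in lborel. w x = w' x"
  shows "dyadic_grid.dyadic_maximal a l (\<lambda>x. ennreal (w' x)) x \<le> maximal_function w x"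
proof -
  interpret dyadic_grid a l by (rule G)
  have "(\<integral>\<^sup>+y\<in>cell k x. ennreal (w' y) \<partial>lborel) / emeasure lborel (cell k x) \<le> maximal_function w x" for k
  proof -
    have cube: "is_cube (cell k x)"
    proof -
      obtain c where "cell k x = half_open_cube c (l / 2 ^ k)" using cell_half_open_cube by blast
      then show ?thesis using l by (simp add: is_cube_half_open_cube)
    qed
    have "(\<integral>\<^sup>+y\<in>cell k x. ennreal (w' y) \<partial>lborel) = (\<integral>\<^sup>+y\<in>cell k x. ennreal (w' y) \<partial>lebesgue)"
      by (simp add: nn_integral_completion)
    also have "\<dots> \<le> (\<integral>\<^sup>+y\<in>cell k x. ennreal \<bar>w y\<bar> \<partial>lebesgue)"
      using ae unfolding AE_lebesgue_iff[symmetric]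
      by (intro nn_integral_mono_AE) (auto elim!: eventually_mono intro!: mult_right_mono ennreal_leI)
    finally have "(\<integral>\<^sup>+y\<in>cell k x. ennreal (w' y) \<partial>lborel) / emeasure lborel (cell k x)
      \<le> (\<integral>\<^sup>+y\<in>cell k x. ennreal \<bar>w y\<bar> \<partial>lebesgue) / emeasure lebesgue (cell k x)"
      by (auto intro!: divide_right_mono_ennreal)
    also have "\<dots> \<le> maximal_function w x"
      unfolding maximal_function_def by (rule SUP_upper) (use cube in auto)
    finally show ?thesis .
  qed
  then show ?thesis unfolding dyadic_maximal_def by (rule SUP_least)
qed

definition fractional_energy :: "(real ^ 'n \<Rightarrow> real) \<Rightarrow> real \<Rightarrow> (real ^ 'n \<Rightarrow> real) \<Rightarrow> ennreal" where
  "fractional_energy w \<delta> u = (\<integral>\<^sup>+ x. (\<integral>\<^sup>+ y. ennreal (\<bar>u x - u y\<bar> / norm (x - y) powr (real CARD('n) + \<delta>)) \<partial>lebesgue)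
               * ennreal_powr (maximal_function w x) ((real CARD('n) - \<delta>) / real CARD('n)) \<partial>lebesgue)"

text \<open>Replacing Borel versions by the original functions changes the integrands on null sets only; the rest
  is monotonicity of the integral, in the domain and in the weight.\<close>
lemma dyadic_energy_le_fractional_energy:
  fixes w u :: "real ^ 'n \<Rightarrow> real"
  assumes G: "dyadic_grid l" and aew: "AE x in lborel. w x = w' x" and aeu: "AE x in lborel. u x = u' x"
    and \<delta>: "\<delta> < 1"
  shows "(\<integral>\<^sup>+x\<in>H. (\<integral>\<^sup>+y\<in>H. ennreal \<bar>u' x - u' y\<bar> * frac_kernel \<delta> x y \<partial>lborel)
        * ennreal_powr (dyadic_grid.dyadic_maximal a l (\<lambda>x. ennreal (w' x)) x) ((real CARD('n) - \<delta>) / real CARD('n)) \<partial>lborel)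
     \<le> fractional_energy w \<delta> u"
proof -
  have n1: "1 \<le> real CARD('n)" by simp
  have \<alpha>: "0 < (real CARD('n) - \<delta>) / real CARD('n)" using n1 \<delta> by (intro divide_pos_pos) linarith+
  have ae: "AE x in lebesgue. u x = u' x" using aeu unfolding AE_lebesgue_iff .
  have inner: "(\<integral>\<^sup>+y\<in>H. ennreal \<bar>u' x - u' y\<bar> * frac_kernel \<delta> x y \<partial>lborel) \<le>
      (\<integral>\<^sup>+ y. ennreal (\<bar>u x - u y\<bar> / norm (x - y) powr (real CARD('n) + \<delta>)) \<partial>lebesgue)" if x: "u x = u' x" for x
  proof -
    have "(\<integral>\<^sup>+y\<in>H. ennreal \<bar>u' x - u' y\<bar> * frac_kernel \<delta> x y \<partial>lborel) =
       (\<integral>\<^sup>+y\<in>H. ennreal \<bar>u' x - u' y\<bar> * frac_kernel \<delta> x y \<partial>lebesgue)"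
      by (simp add: nn_integral_completion)
    also have "\<dots> \<le> (\<integral>\<^sup>+ y. ennreal (\<bar>u x - u y\<bar> / norm (x - y) powr (real CARD('n) + \<delta>)) \<partial>lebesgue)"
    proof (rule nn_integral_mono_AE)
      show "AE y in lebesgue. ennreal \<bar>u' x - u' y\<bar> * frac_kernel \<delta> x y * indicator H y
         \<le> ennreal (\<bar>u x - u y\<bar> / norm (x - y) powr (real CARD('n) + \<delta>))"
        using ae
        by eventually_elim (auto simp: x frac_kernel_def ennreal_mult'[symmetric] indicator_def)
    qed
    finally show ?thesis .
  qed
  show ?thesis
    unfolding fractional_energy_def nn_integral_completion[of lborel, symmetric]
  proof (rule nn_integral_mono_AE)
    show "AE x in lebesgue. (\<integral>\<^sup>+y\<in>H. ennreal \<bar>u' x - u' y\<bar> * frac_kernel \<delta> x y \<partial>lebesgue)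
        * ennreal_powr (dyadic_grid.dyadic_maximal a l (\<lambda>x. ennreal (w' x)) x) ((real CARD('n) - \<delta>) / real CARD('n)) * indicator H x
      \<le> (\<integral>\<^sup>+ y. ennreal (\<bar>u x - u y\<bar> / norm (x - y) powr (real CARD('n) + \<delta>)) \<partial>lebesgue)
               * ennreal_powr (maximal_function w x) ((real CARD('n) - \<delta>) / real CARD('n))"
      using ae
    proof eventually_elim
      case (elim x)
      have V: "ennreal_powr (dyadic_grid.dyadic_maximal a l (\<lambda>x. ennreal (w' x)) x) ((real CARD('n) - \<delta>) / real CARD('n))
        \<le> ennreal_powr (maximal_function w x) ((real CARD('n) - \<delta>) / real CARD('n))"
        by (intro ennreal_powr_mono dyadic_maximal_le_maximal_function G aew \<alpha>)
      show ?case
        using mult_mono[OF inner[OF elim] V] by (auto simp: indicator_def nn_integral_completion)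
    qed
  qed
qed

text \<open>The function \<open>\<bar>u - A\<bar>\<close> is truncated at \<open>K\<close> in order to satisfy the boundedness hypothesis of the
  Minkowski-type inequality; the bound does not depend on \<open>K\<close>.  Borel versions \<open>w'\<close> and \<open>u'\<close> of the weight
  and of the function allow the use of product measures of \<^term>\<open>lborel\<close>.\<close>
proposition weighted_Poincare_Sobolev_is_cube:
  fixes w u w' u' :: "real ^ 'n \<Rightarrow> real"
  assumes w: "weight w" and wloc: "locally_integrable (density lebesgue (\<lambda>x. ennreal (w x))) u"
    and ulm: "u \<in> borel_measurable lebesgue"
    and w'[measurable]: "w' \<in> borel_measurable borel" and u'[measurable]: "u' \<in> borel_measurable borel"
    and aew: "AE x in lborel. w x = w' x" and aeu: "AE x in lborel. u x = u' x"
    and Q: "is_cube Q" and \<delta>: "0 < \<delta>" "\<delta> < 1" and K: "0 \<le> K"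
  defines "A \<equiv> (LINT x:Q|lebesgue. u x * w x) / (LINT x:Q|lebesgue. w x)"
  shows "ennreal_powr (\<integral>\<^sup>+x\<in>Q. ennreal (min \<bar>u' x - A\<bar> K powr (real CARD('n) / (real CARD('n) - \<delta>))) * ennreal (w' x) \<partial>lborel)
      ((real CARD('n) - \<delta>) / real CARD('n))
    \<le> ennreal (2 ^ (CARD('n) + 4) * real CARD('n) ^ (CARD('n) + 1) * (1 - \<delta>)) * fractional_energy w \<delta> u"
proof -
  obtain a l where l: "0 < l" and Qb[measurable]: "Q \<in> sets borel" and QK: "Q \<subseteq> cbox a (a + l *\<^sub>R One)"
    and QH: "AE x in lborel. x \<in> Q \<longleftrightarrow> x \<in> half_open_cube a l"
    using is_cube_AE_half_open_cube[OF Q] .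
  interpret dyadic_grid a l by unfold_locales (rule l)
  define H where "H = half_open_cube a l"
  define B where "B = cbox a (a + l *\<^sub>R One)"
  have cell: "cell 0 a = H" by (simp add: H_def cell_0)
  have [measurable]: "H \<in> sets borel" "B \<in> sets borel" by (auto simp: H_def B_def)
  have HB: "H \<subseteq> B" unfolding H_def B_def by (rule half_open_cube_bounds)
  have wlm: "w \<in> borel_measurable lebesgue"
    using w by (intro locally_integrable_imp_measurable[of lebesgue]) (auto simp: weight_def)
  have wpos: "AE x in lborel. 0 < w' x"
    using w aew unfolding weight_def AE_lebesgue_iff by (auto elim: eventually_elim2)
  define g where "g x = w' x * indicator H x" for x
  have g[measurable]: "g \<in> borel_measurable borel" unfolding g_def by measurable
  have g0: "AE x in lborel. 0 \<le> g x" using wpos by eventually_elim (auto simp: g_def)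
  have gint: "integrable lborel g"
  proof -
    have "integrable lebesgue (\<lambda>x. indicator B x *\<^sub>R w x)"
      using w by (auto simp: weight_def locally_integrable_def set_integrable_def B_def)
    then have "integrable lebesgue (\<lambda>x. indicator B x *\<^sub>R w' x)"
      by (rule integrable_cong_AE_imp) (use aew in \<open>auto simp: AE_lebesgue_iff elim!: eventually_mono intro!: measurable_completion\<close>)
    then have "integrable lborel (\<lambda>x. indicator B x *\<^sub>R w' x)"
      by (subst (asm) integrable_completion) auto
    then have "integrable lborel (\<lambda>x. indicator H x *\<^sub>R (indicator B x *\<^sub>R w' x))"
      by (rule integrable_mult_indicator[rotated]) auto
    also have "(\<lambda>x. indicator H x *\<^sub>R (indicator B x *\<^sub>R w' x)) = g"
      using HB by (auto simp: g_def indicator_def fun_eq_iff)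
    finally show ?thesis .
  qed
  have guint: "integrable lborel (\<lambda>x. g x * u' x)"
  proof -
    have "integrable (density lebesgue (\<lambda>x. ennreal (w x))) (\<lambda>x. indicator B x *\<^sub>R u x)"
      using wloc by (auto simp: locally_integrable_def set_integrable_def B_def)
    moreover have "(\<lambda>x. indicator B x * u x) \<in> borel_measurable lebesgue"
      using ulm by (intro borel_measurable_times borel_measurable_indicator) auto
    ultimately have "integrable lebesgue (\<lambda>x. w x *\<^sub>R (indicator B x *\<^sub>R u x))"
      using w wlm by (subst (asm) integrable_density) (auto simp: weight_def elim!: eventually_mono)
    then have "integrable lebesgue (\<lambda>x. w' x *\<^sub>R (indicator B x *\<^sub>R u' x))"
      by (rule integrable_cong_AE_imp)
         (use aew aeu in \<open>auto simp: AE_lebesgue_iff elim!: eventually_elim2 intro!: measurable_completion\<close>)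
    then have "integrable lborel (\<lambda>x. w' x *\<^sub>R (indicator B x *\<^sub>R u' x))"
      by (subst (asm) integrable_completion) auto
    then have "integrable lborel (\<lambda>x. indicator H x *\<^sub>R (w' x *\<^sub>R (indicator B x *\<^sub>R u' x)))"
      by (rule integrable_mult_indicator[rotated]) auto
    also have "(\<lambda>x. indicator H x *\<^sub>R (w' x *\<^sub>R (indicator B x *\<^sub>R u' x))) = (\<lambda>x. g x * u' x)"
      using HB by (auto simp: g_def indicator_def fun_eq_iff)
    finally show ?thesis .
  qed
  define \<nu> where "\<nu> = density lborel (\<lambda>x. ennreal (w' x) * indicator (cell 0 a) x)"
  have \<nu>: "\<nu> = density lborel (\<lambda>x. ennreal (g x))"
    unfolding \<nu>_def cell by (intro arg_cong[where f="density lborel"]) (auto simp: g_def indicator_def)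
  have sp: "space \<nu> = UNIV" by (simp add: \<nu>)
  have mass: "emeasure \<nu> UNIV = ennreal (\<integral>x. g x \<partial>lborel)"
    using gint g0 unfolding \<nu> by (subst emeasure_density) (auto intro!: nn_integral_eq_integral)
  have gnn: "0 \<le> (\<integral>x. g x \<partial>lborel)" by (rule integral_nonneg_AE) (rule g0)
  have meas: "measure \<nu> UNIV = (\<integral>x. g x \<partial>lborel)" using mass gnn by (simp add: measure_def)
  have fm: "finite_measure \<nu>" by (intro finite_measureI) (simp add: sp mass)
  have pos: "0 < emeasure \<nu> UNIV"
  proof (rule ccontr)
    assume "\<not> 0 < emeasure \<nu> UNIV"
    then have "(\<integral>\<^sup>+x. ennreal (g x) \<partial>lborel) = 0" unfolding \<nu> by (subst (asm) emeasure_density) auto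
    then have "AE x in lborel. ennreal (g x) = 0" by (subst (asm) nn_integral_0_iff_AE) auto
    then have "AE x in lborel. x \<notin> H"
      using wpos by eventually_elim (auto simp: g_def indicator_def ennreal_eq_0_iff split: if_splits)
    then have "emeasure lborel H = 0" by (subst (asm) AE_iff_measurable[of H]) auto
    then show False using l by (simp add: H_def emeasure_half_open_cube)
  qed
  have int\<nu>: "integrable \<nu> u'"
    unfolding \<nu> using guint g0 by (subst integrable_density) auto
  have "(\<integral>x. u' x \<partial>\<nu>) = (\<integral>x. g x * u' x \<partial>lborel)"
    unfolding \<nu> using g0 by (subst integral_density) auto
  also have "\<dots> = (\<integral>x. g x * u' x \<partial>lebesgue)" by (rule integral_completion[symmetric]) simp
  also have "\<dots> = (LINT x:Q|lebesgue. u x * w x)"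
    unfolding set_lebesgue_integral_def
  proof (rule integral_cong_AE)
    show "AE x in lebesgue. g x * u' x = indicator Q x *\<^sub>R (u x * w x)"
      using aew aeu QH unfolding AE_lebesgue_iff
      by eventually_elim (auto simp: g_def H_def indicator_def)
    show "(\<lambda>x. indicator Q x *\<^sub>R (u x * w x)) \<in> borel_measurable lebesgue"
      using ulm wlm by (intro borel_measurable_scaleR borel_measurable_times) (auto intro!: borel_measurable_indicator)
    show "(\<lambda>x. g x * u' x) \<in> borel_measurable lebesgue"
      by (intro measurable_completion) simp
  qed
  finally have num: "(\<integral>x. u' x \<partial>\<nu>) = (LINT x:Q|lebesgue. u x * w x)" .
  have "(\<integral>x. g x \<partial>lborel) = (\<integral>x. g x \<partial>lebesgue)" by (rule integral_completion[symmetric]) simp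
  also have "\<dots> = (LINT x:Q|lebesgue. w x)"
    unfolding set_lebesgue_integral_def
  proof (rule integral_cong_AE)
    show "AE x in lebesgue. g x = indicator Q x *\<^sub>R w x"
      using aew QH unfolding AE_lebesgue_iff
      by eventually_elim (auto simp: g_def H_def indicator_def)
    show "(\<lambda>x. indicator Q x *\<^sub>R w x) \<in> borel_measurable lebesgue"
      using wlm by (intro borel_measurable_scaleR) (auto intro!: borel_measurable_indicator)
    show "g \<in> borel_measurable lebesgue"
      by (intro measurable_completion) simp
  qed
  finally have A: "A = (\<integral>x. u' x \<partial>\<nu>) / measure \<nu> (space \<nu>)"
    by (simp add: A_def num sp meas)
  have mpos: "0 < measure \<nu> (space \<nu>)" using pos unfolding mass sp meas by simp
  have dev: "ennreal (min \<bar>u' x - A\<bar> K) * emeasure \<nu> UNIV \<le> (\<integral>\<^sup>+y. ennreal \<bar>u' x - u' y\<bar> \<partial>\<nu>)" for x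
  proof -
    have "ennreal (min \<bar>u' x - A\<bar> K) * emeasure \<nu> UNIV \<le> ennreal \<bar>u' x - A\<bar> * emeasure \<nu> (space \<nu>)"
      unfolding sp by (intro mult_right_mono ennreal_leI) auto
    also have "\<dots> \<le> (\<integral>\<^sup>+y. ennreal \<bar>u' x - u' y\<bar> \<partial>\<nu>)"
      unfolding A by (rule mean_deviation_le[OF fm int\<nu> mpos])
    finally show ?thesis .
  qed
  have "(\<integral>\<^sup>+x\<in>Q. ennreal (min \<bar>u' x - A\<bar> K powr (real CARD('n) / (real CARD('n) - \<delta>))) * ennreal (w' x) \<partial>lborel)
     = (\<integral>\<^sup>+x\<in>cell 0 a. ennreal (min \<bar>u' x - A\<bar> K powr (real CARD('n) / (real CARD('n) - \<delta>))) * ennreal (w' x) \<partial>lborel)"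
    using QH unfolding cell H_def by (intro nn_integral_cong_AE) (auto elim!: eventually_mono simp: indicator_def)
  also have "ennreal_powr \<dots> ((real CARD('n) - \<delta>) / real CARD('n)) \<le>
    ennreal (2 ^ (CARD('n) + 4) * real CARD('n) ^ (CARD('n) + 1) * (1 - \<delta>)) *
     (\<integral>\<^sup>+x\<in>cell 0 a. (\<integral>\<^sup>+y\<in>cell 0 a. ennreal \<bar>u' x - u' y\<bar> * frac_kernel \<delta> x y \<partial>lborel)
        * ennreal_powr (dyadic_maximal (\<lambda>x. ennreal (w' x)) x) ((real CARD('n) - \<delta>) / real CARD('n)) \<partial>lborel)"
    using weighted_Poincare_Sobolev_cube[of "\<lambda>x. ennreal (w' x)" u' "\<lambda>x. min \<bar>u' x - A\<bar> K" K \<delta>,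
        folded \<nu>_def, OF _ _ _ _ _ \<delta> _ pos dev] K
    by (simp add: mass)
  also have "\<dots> \<le> ennreal (2 ^ (CARD('n) + 4) * real CARD('n) ^ (CARD('n) + 1) * (1 - \<delta>)) * fractional_energy w \<delta> u"
    by (intro mult_left_mono dyadic_energy_le_fractional_energy aew aeu \<delta> dyadic_grid_axioms) simp
  finally show ?thesis .
qed

theorem corollary2p11:
  shows "\<exists>c::real. 0 < c \<and>
    (\<forall>(w :: real ^ 'n \<Rightarrow> real) (\<delta>::real) (u :: real ^ 'n \<Rightarrow> real).
      weight w \<longrightarrow> 1 / 2 \<le> \<delta> \<longrightarrow> \<delta> < 1 \<longrightarrow> u \<in> class_F w \<longrightarrow>
      ennreal_powr
        (\<integral>\<^sup>+ x. ennreal (\<bar>u x\<bar> powr (real CARD('n) / (real CARD('n) - \<delta>)) * w x) \<partial>lebesgue)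
        ((real CARD('n) - \<delta>) / real CARD('n))
      \<le> ennreal (c * (1 - \<delta>)) *
        (\<integral>\<^sup>+ x. (\<integral>\<^sup>+ y. ennreal (\<bar>u x - u y\<bar> / norm (x - y) powr (real CARD('n) + \<delta>)) \<partial>lebesgue)
               * ennreal_powr (maximal_function w x) ((real CARD('n) - \<delta>) / real CARD('n)) \<partial>lebesgue))"
proof (intro exI conjI allI impI)
  let ?c = "2 ^ (CARD('n) + 4) * real CARD('n) ^ (CARD('n) + 1)"
  show "0 < ?c" by simp
  fix w u :: "real ^ 'n \<Rightarrow> real" and \<delta> :: real
  assume w: "weight w" and \<delta>: "1 / 2 \<le> \<delta>" "\<delta> < 1" and u: "u \<in> class_F w"
  define p where "p = real CARD('n) / (real CARD('n) - \<delta>)"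
  define \<alpha> where "\<alpha> = (real CARD('n) - \<delta>) / real CARD('n)"
  have n1: "1 \<le> real CARD('n)" by simp
  have \<alpha>: "0 < \<alpha>" unfolding \<alpha>_def using n1 \<delta> by (intro divide_pos_pos) linarith+
  have p: "0 < p" unfolding p_def using n1 \<delta> by (intro divide_pos_pos) linarith+
  have wlm: "w \<in> borel_measurable lebesgue"
    using w by (intro locally_integrable_imp_measurable[of lebesgue]) (auto simp: weight_def)
  have ulm: "u \<in> borel_measurable lebesgue"
    using u by (intro locally_integrable_imp_measurable[of lebesgue]) (auto simp: class_F_def)
  obtain w' where w'[measurable]: "w' \<in> borel_measurable borel" and aew: "AE x in lborel. w x = w' x"
    using completion_ex_borel_measurable_real[OF wlm] by auto
  obtain u' where u'[measurable]: "u' \<in> borel_measurable borel" and aeu: "AE x in lborel. u x = u' x"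
    using completion_ex_borel_measurable_real[OF ulm] by auto
  have wloc: "locally_integrable (density lebesgue (\<lambda>x. ennreal (w x))) u" using u by (simp add: class_F_def)
  obtain Q where Q: "\<And>j. is_cube (Q j)" "incseq Q" "(\<Union>j. Q j) = UNIV"
    and lim: "(\<lambda>j. (LINT x:Q j|lebesgue. u x * w x) / (LINT x:Q j|lebesgue. w x)) \<longlonglongrightarrow> 0"
    using u unfolding class_F_def by blast
  have Qb[measurable]: "Q j \<in> sets borel" for j using is_cube_AE_half_open_cube[OF Q(1)] by blast
  define A where "A j = (LINT x:Q j|lebesgue. u x * w x) / (LINT x:Q j|lebesgue. w x)" for j
  have A: "A \<longlonglongrightarrow> 0" using lim by (simp add: A_def[abs_def])
  define X where "X = ennreal (?c * (1 - \<delta>)) * fractional_energy w \<delta> u"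
  define F where "F j x = ennreal (min \<bar>u' x - A j\<bar> (real j) powr p) * ennreal (w' x) * indicator (Q j) x" for j x
  have F[measurable]: "F j \<in> borel_measurable borel" for j unfolding F_def by measurable
  have bound: "(\<integral>\<^sup>+x. F j x \<partial>lborel) \<le> ennreal_powr X (1 / \<alpha>)" for j
  proof -
    have "ennreal_powr (\<integral>\<^sup>+x. F j x \<partial>lborel) \<alpha> \<le> X"
      unfolding X_def F_def A_def p_def \<alpha>_def using \<delta>
      by (intro weighted_Poincare_Sobolev_is_cube[OF w wloc ulm w' u' aew aeu Q(1)]) auto
    then show ?thesis using \<alpha> by (simp add: ennreal_powr_le_iff)
  qed
  \<comment> \<open>The truncation level \<open>j\<close> grows with the cube, so a single application of Fatou's lemma removes it.\<close>
  have lim_F: "(\<lambda>j. F j x) \<longlonglongrightarrow> ennreal (\<bar>u' x\<bar> powr p) * ennreal (w' x)" for x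
  proof -
    obtain j0 where j0: "x \<in> Q j0" using Q(3) by blast
    have inQ: "x \<in> Q j" if "j0 \<le> j" for j using j0 Q(2) that by (auto simp: incseq_def)
    obtain j1 :: nat where j1: "\<bar>u' x\<bar> + 1 \<le> j1" using real_arch_simple by blast
    obtain j2 where j2: "\<And>j. j2 \<le> j \<Longrightarrow> \<bar>A j\<bar> < 1" using A[THEN LIMSEQ_D, of 1] by auto
    have ev: "\<forall>\<^sub>F j in sequentially. F j x = ennreal (\<bar>u' x - A j\<bar> powr p) * ennreal (w' x)"
    proof (rule eventually_sequentiallyI[of "max j0 (max j1 j2)"])
      fix j assume j: "max j0 (max j1 j2) \<le> j"
      then have "\<bar>A j\<bar> < 1" "real j1 \<le> real j" "x \<in> Q j" using j2 inQ by auto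
      then have "\<bar>u' x - A j\<bar> \<le> j" using j1 by linarith
      then show "F j x = ennreal (\<bar>u' x - A j\<bar> powr p) * ennreal (w' x)" using \<open>x \<in> Q j\<close> by (simp add: F_def)
    qed
    have "(\<lambda>j. \<bar>u' x - A j\<bar> powr p) \<longlonglongrightarrow> \<bar>u' x - 0\<bar> powr p"
      using p by (intro tendsto_powr' tendsto_rabs tendsto_diff A tendsto_const) auto
    then have "(\<lambda>j. ennreal (\<bar>u' x - A j\<bar> powr p * w' x)) \<longlonglongrightarrow> ennreal (\<bar>u' x\<bar> powr p * w' x)"
      by (intro tendsto_ennrealI tendsto_mult_right) simp
    then have "(\<lambda>j. ennreal (\<bar>u' x - A j\<bar> powr p) * ennreal (w' x)) \<longlonglongrightarrow> ennreal (\<bar>u' x\<bar> powr p) * ennreal (w' x)"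
      by (simp add: ennreal_mult')
    then show ?thesis by (rule Lim_transform_eventually) (use ev in \<open>auto elim: eventually_mono\<close>)
  qed
  have "(\<integral>\<^sup>+ x. ennreal (\<bar>u x\<bar> powr p * w x) \<partial>lebesgue) = (\<integral>\<^sup>+ x. ennreal (\<bar>u' x\<bar> powr p) * ennreal (w' x) \<partial>lebesgue)"
    using aew aeu unfolding AE_lebesgue_iff[symmetric]
    by (intro nn_integral_cong_AE) (auto elim!: eventually_elim2 simp: ennreal_mult')
  also have "\<dots> = (\<integral>\<^sup>+ x. liminf (\<lambda>j. F j x) \<partial>lborel)"
    unfolding nn_integral_completion
    using lim_F by (intro nn_integral_cong) (metis lim_imp_Liminf trivial_limit_sequentially)
  also have "\<dots> \<le> liminf (\<lambda>j. \<integral>\<^sup>+ x. F j x \<partial>lborel)"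
    by (rule nn_integral_liminf) simp
  also have "\<dots> \<le> liminf (\<lambda>j::nat. ennreal_powr X (1 / \<alpha>))"
    by (rule Liminf_mono) (use bound in auto)
  also have "\<dots> = ennreal_powr X (1 / \<alpha>)" by (simp add: Liminf_const)
  finally have "ennreal_powr (\<integral>\<^sup>+ x. ennreal (\<bar>u x\<bar> powr p * w x) \<partial>lebesgue) \<alpha> \<le> X"
    using \<alpha> by (simp add: ennreal_powr_le_iff)
  then show "ennreal_powr
        (\<integral>\<^sup>+ x. ennreal (\<bar>u x\<bar> powr (real CARD('n) / (real CARD('n) - \<delta>)) * w x) \<partial>lebesgue)
        ((real CARD('n) - \<delta>) / real CARD('n))
      \<le> ennreal (?c * (1 - \<delta>)) *
        (\<integral>\<^sup>+ x. (\<integral>\<^sup>+ y. ennreal (\<bar>u x - u y\<bar> / norm (x - y) powr (real CARD('n) + \<delta>)) \<partial>lebesgue)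
               * ennreal_powr (maximal_function w x) ((real CARD('n) - \<delta>) / real CARD('n)) \<partial>lebesgue)"
    by (simp only: p_def \<alpha>_def X_def fractional_energy_def)
qed

end
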